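(* Let $\varphi:M\to\mathbf{R}^{n+1}$ be a parabolic sphere with induced connection $\nabla$ and Blaschke metric $g$. Then $\varphi$ arises as a Blaschke immersion of a special Kähler manifold (that is, there exists a complex structure $J$ on $M$ such that $(M,\nabla,g)$ together with $J$ is a special Kähler manifold) if and only if the parabolic sphere $(M,\nabla,g)$ is special (that is, there exists an almost complex structure $J$ on $M$ such that $g$ is $J$-Hermitian and the 2-form $\omega:=g(J\cdot,\cdot)$ is $\nabla$-parallel).
   Context: Special Kähler manifolds. Let $(M,J,g)$ be a Kähler manifold with possibly indefinite Kähler metric $g$: $J$ is an integrable complex structure, $g$ is a pseudo-Riemannian metric with $g(J\cdot,J\cdot)=g$, and the Kähler form $\omega := g(\cdot,J\cdot)$ is closed. Let $\nabla$ be a torsionfree flat connection on $M$ (i.e. on the tangent bundle). The triple $(M,\nabla,g)$ (with $J$ understood) is called a special Kähler manifold if $\nabla\omega=0$ and $d^\nabla J=0$, where $d^\nabla J(X,Y) = (\nabla_XJ)Y-(\nabla_YJ)X$. Affine immersions. $\mathbf{R}^{n+1}$ is regarded as affine space with its standard volume form $\det$ and standard flat connection $D$. Let $\varphi:M\to\mathbf{R}^{n+1}$ be an immersion of an $n$-dimensional manifold and $\xi$ a vector field along $\varphi$ transversal to $\varphi$. The formulas $$D_X\varphi_*Y=\varphi_*(\nabla_XY)+g(X,Y)\xi,\qquad D_X\xi=-\varphi_*(SX)+\tau(X)\xi$$ define a torsionfree connection $\nabla$ (the induced connection), a symmetric bilinear form $g$, an endomorphism field $S$ (the shape tensor) and a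 1-form $\tau$; one also has the induced volume form $\theta(X_1,\ldots,X_n)=\det(\xi,\varphi_*X_1,\ldots,\varphi_*X_n)$. If $g$ is nondegenerate (a condition independent of $\xi$), then $\xi$ is called an affine normal if the metric volume form $\nu$ of $g$ (for a suitable orientation of $M$) is $\nabla$-parallel and coincides with $\theta$. The immersion $\varphi$ together with an affine normal $\xi$ is called a Blaschke immersion, and the corresponding pseudo-Riemannian metric $g$ is called its Blaschke metric. A Blaschke immersion is called an affine hypersphere if $S=\lambda\,\mathrm{Id}$ for some $\lambda\in\mathbf{R}$, and it is called parabolic (a parabolic sphere) if $\lambda=0$. A parabolic sphere with induced connection $\nabla$ and Blaschke metric $g$ is also denoted $(M,\nabla,g)$. The metric $g$ is called $J$-Hermitian if $g(J\cdot,J\cdot)=g$. *)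

theory Defs
  imports "HOL-Analysis.Analysis"
begin

section \<open>Smooth maps between Euclidean spaces\<close>

text \<open>Meant for open \<open>S\<close>.  The recursion runs over directional derivatives, so that the type of
  the map does not change.\<close>

primrec Ck_on :: "nat \<Rightarrow> 'a::euclidean_space set \<Rightarrow> ('a \<Rightarrow> 'b::real_normed_vector) \<Rightarrow> bool" where
  "Ck_on 0 S f \<longleftrightarrow> continuous_on S f"
| "Ck_on (Suc k) S f \<longleftrightarrow> (\<forall>x\<in>S. f differentiable (at x)) \<and>
     (\<forall>v. Ck_on k S (\<lambda>x. frechet_derivative f (at x) v))"

definition smooth_on :: "'a::euclidean_space set \<Rightarrow> ('a \<Rightarrow> 'b::real_normed_vector) \<Rightarrow> bool" where
  "smooth_on S f \<longleftrightarrow> (\<forall>k. Ck_on k S f)"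

section \<open>Smooth manifolds\<close>

text \<open>The underlying set of the manifold is the whole type \<open>'m\<close>; its dimension is \<open>CARD('n)\<close>.
  A chart is an open domain together with a coordinate map, whose values outside the domain are
  irrelevant.\<close>

type_synonym ('m, 'n) chart = "'m set \<times> ('m \<Rightarrow> real ^ 'n)"

abbreviation cdom :: "('m, 'n) chart \<Rightarrow> 'm set" where
  "cdom c \<equiv> fst c"

abbreviation cmap :: "('m, 'n) chart \<Rightarrow> 'm \<Rightarrow> real ^ 'n" where
  "cmap c \<equiv> snd c"

abbreviation cinv :: "('m, 'n) chart \<Rightarrow> real ^ 'n \<Rightarrow> 'm" where
  "cinv c \<equiv> inv_into (cdom c) (cmap c)"

definition smooth_atlas ::
  "('m::{t2_space, second_countable_topology}, 'n::finite) chart set \<Rightarrow> bool" where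
  "smooth_atlas A \<longleftrightarrow>
     (\<forall>c\<in>A. open (cdom c) \<and> open (cmap c ` cdom c) \<and>
        homeomorphism (cdom c) (cmap c ` cdom c) (cmap c) (cinv c)) \<and>
     (\<Union>c\<in>A. cdom c) = UNIV \<and>
     (\<forall>c\<in>A. \<forall>d\<in>A. smooth_on (cmap c ` (cdom c \<inter> cdom d)) (cmap d \<circ> cinv c))"

definition smooth_in ::
  "('m, 'n::finite) chart \<Rightarrow> ('m \<Rightarrow> 'b::real_normed_vector) \<Rightarrow> bool" where
  "smooth_in c f \<longleftrightarrow> smooth_on (cmap c ` cdom c) (f \<circ> cinv c)"

text \<open>The differential at \<open>p\<close> of a map with values in a vector space, applied to the tangent vector
  whose components in the chart \<open>c\<close> are \<open>v\<close>.\<close>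

definition dif ::
  "('m, 'n::finite) chart \<Rightarrow> ('m \<Rightarrow> 'b::real_normed_vector) \<Rightarrow> 'm \<Rightarrow> real ^ 'n \<Rightarrow> 'b" where
  "dif c f p v = frechet_derivative (f \<circ> cinv c) (at (cmap c p)) v"

section \<open>Tensor fields and connections\<close>

text \<open>A tangent vector at \<open>p\<close> is given by its components in the charts around \<open>p\<close>; the components
  \<open>v\<close> in the chart \<open>c\<close> and \<open>dif c (cmap d) p v\<close> in the chart \<open>d\<close> describe the same vector.
  Accordingly a tensor field is a family, indexed by the charts \<open>c\<close> of the atlas and the points
  \<open>p \<in> cdom c\<close>, of (multi)linear maps on \<open>real ^ 'n\<close> that transforms correctly under changes of
  charts; values for other \<open>c\<close> and \<open>p\<close> are irrelevant.  In contrast, \<open>X :: 'm \<Rightarrow> real ^ 'n\<close> with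
  \<open>smooth_in c X\<close> stands for a single smooth vector field on \<open>cdom c\<close>, written in the chart \<open>c\<close>.\<close>

type_synonym ('m, 'n) form1 = "('m, 'n) chart \<Rightarrow> 'm \<Rightarrow> real ^ 'n \<Rightarrow> real"
type_synonym ('m, 'n) form2 = "('m, 'n) chart \<Rightarrow> 'm \<Rightarrow> real ^ 'n \<Rightarrow> real ^ 'n \<Rightarrow> real"
type_synonym ('m, 'n) formn = "('m, 'n) chart \<Rightarrow> 'm \<Rightarrow> ('n \<Rightarrow> real ^ 'n) \<Rightarrow> real"
type_synonym ('m, 'n) endo = "('m, 'n) chart \<Rightarrow> 'm \<Rightarrow> real ^ 'n \<Rightarrow> real ^ 'n"
type_synonym ('m, 'n) conn = "('m, 'n) chart \<Rightarrow> 'm \<Rightarrow> real ^ 'n \<Rightarrow> real ^ 'n \<Rightarrow> real ^ 'n"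

definition one_form :: "('m, 'n::finite) chart set \<Rightarrow> ('m, 'n) form1 \<Rightarrow> bool" where
  "one_form A \<tau> \<longleftrightarrow>
     (\<forall>c\<in>A. \<forall>p\<in>cdom c. linear (\<tau> c p)) \<and>
     (\<forall>c\<in>A. \<forall>v. smooth_in c (\<lambda>p. \<tau> c p v)) \<and>
     (\<forall>c\<in>A. \<forall>d\<in>A. \<forall>p\<in>cdom c \<inter> cdom d. \<forall>v. \<tau> c p v = \<tau> d p (dif c (cmap d) p v))"

definition bilinear_form :: "('m, 'n::finite) chart set \<Rightarrow> ('m, 'n) form2 \<Rightarrow> bool" where
  "bilinear_form A g \<longleftrightarrow>
     (\<forall>c\<in>A. \<forall>p\<in>cdom c. bilinear (g c p)) \<and>
     (\<forall>c\<in>A. \<forall>u v. smooth_in c (\<lambda>p. g c p u v)) \<and>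
     (\<forall>c\<in>A. \<forall>d\<in>A. \<forall>p\<in>cdom c \<inter> cdom d. \<forall>u v.
        g c p u v = g d p (dif c (cmap d) p u) (dif c (cmap d) p v))"

definition endo_field :: "('m, 'n::finite) chart set \<Rightarrow> ('m, 'n) endo \<Rightarrow> bool" where
  "endo_field A J \<longleftrightarrow>
     (\<forall>c\<in>A. \<forall>p\<in>cdom c. linear (J c p)) \<and>
     (\<forall>c\<in>A. \<forall>v. smooth_in c (\<lambda>p. J c p v)) \<and>
     (\<forall>c\<in>A. \<forall>d\<in>A. \<forall>p\<in>cdom c \<inter> cdom d. \<forall>v.
        dif c (cmap d) p (J c p v) = J d p (dif c (cmap d) p v))"

text \<open>A connection is given by its Christoffel symbols in each chart, so that
  \<open>\<nabla>\<^sub>X Y = D\<^sub>X Y + \<Gamma>(X, Y)\<close> in components.  The last clause is the transformation law of Christoffel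
  symbols; its second-order term is the Hessian of the change of charts.\<close>

definition connection :: "('m, 'n::finite) chart set \<Rightarrow> ('m, 'n) conn \<Rightarrow> bool" where
  "connection A \<Gamma> \<longleftrightarrow>
     (\<forall>c\<in>A. \<forall>p\<in>cdom c. bilinear (\<Gamma> c p)) \<and>
     (\<forall>c\<in>A. \<forall>u v. smooth_in c (\<lambda>p. \<Gamma> c p u v)) \<and>
     (\<forall>c\<in>A. \<forall>d\<in>A. \<forall>p\<in>cdom c \<inter> cdom d. \<forall>u v.
        dif c (cmap d) p (\<Gamma> c p u v) =
          dif c (\<lambda>q. dif c (cmap d) q v) p u
          + \<Gamma> d p (dif c (cmap d) p u) (dif c (cmap d) p v))"

definition cov :: "('m, 'n::finite) conn \<Rightarrow> ('m, 'n) chart \<Rightarrow>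
    ('m \<Rightarrow> real ^ 'n) \<Rightarrow> ('m \<Rightarrow> real ^ 'n) \<Rightarrow> 'm \<Rightarrow> real ^ 'n" where
  "cov \<Gamma> c X Y p = dif c Y p (X p) + \<Gamma> c p (X p) (Y p)"

definition bracket :: "('m, 'n::finite) chart \<Rightarrow>
    ('m \<Rightarrow> real ^ 'n) \<Rightarrow> ('m \<Rightarrow> real ^ 'n) \<Rightarrow> 'm \<Rightarrow> real ^ 'n" where
  "bracket c X Y p = dif c Y p (X p) - dif c X p (Y p)"

definition torsion_free :: "('m, 'n::finite) chart set \<Rightarrow> ('m, 'n) conn \<Rightarrow> bool" where
  "torsion_free A \<Gamma> \<longleftrightarrow> (\<forall>c\<in>A. \<forall>X Y. smooth_in c X \<longrightarrow> smooth_in c Y \<longrightarrow>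
     (\<forall>p\<in>cdom c. cov \<Gamma> c X Y p - cov \<Gamma> c Y X p = bracket c X Y p))"

definition flat :: "('m, 'n::finite) chart set \<Rightarrow> ('m, 'n) conn \<Rightarrow> bool" where
  "flat A \<Gamma> \<longleftrightarrow> (\<forall>c\<in>A. \<forall>X Y Z. smooth_in c X \<longrightarrow> smooth_in c Y \<longrightarrow> smooth_in c Z \<longrightarrow>
     (\<forall>p\<in>cdom c. cov \<Gamma> c X (cov \<Gamma> c Y Z) p - cov \<Gamma> c Y (cov \<Gamma> c X Z) p
        - cov \<Gamma> c (bracket c X Y) Z p = 0))"

definition parallel2 ::
  "('m, 'n::finite) chart set \<Rightarrow> ('m, 'n) conn \<Rightarrow> ('m, 'n) form2 \<Rightarrow> bool" where
  "parallel2 A \<Gamma> \<omega> \<longleftrightarrow>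
     (\<forall>c\<in>A. \<forall>X Y Z. smooth_in c X \<longrightarrow> smooth_in c Y \<longrightarrow> smooth_in c Z \<longrightarrow>
       (\<forall>p\<in>cdom c. dif c (\<lambda>q. \<omega> c q (Y q) (Z q)) p (X p)
          - \<omega> c p (cov \<Gamma> c X Y p) (Z p) - \<omega> c p (Y p) (cov \<Gamma> c X Z p) = 0))"

definition parallel_vol ::
  "('m, 'n::finite) chart set \<Rightarrow> ('m, 'n) conn \<Rightarrow> ('m, 'n) formn \<Rightarrow> bool" where
  "parallel_vol A \<Gamma> \<nu> \<longleftrightarrow>
     (\<forall>c\<in>A. \<forall>X Y. smooth_in c X \<longrightarrow> (\<forall>i. smooth_in c (Y i)) \<longrightarrow>
       (\<forall>p\<in>cdom c. dif c (\<lambda>q. \<nu> c q (\<lambda>i. Y i q)) p (X p)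
          - (\<Sum>i\<in>UNIV. \<nu> c p ((\<lambda>j. Y j p)(i := cov \<Gamma> c X (Y i) p))) = 0))"

text \<open>\<open>d\<omega> = 0\<close>, through the invariant formula for the exterior derivative of a 2-form.\<close>

definition closed2 :: "('m, 'n::finite) chart set \<Rightarrow> ('m, 'n) form2 \<Rightarrow> bool" where
  "closed2 A \<omega> \<longleftrightarrow>
     (\<forall>c\<in>A. \<forall>X Y Z. smooth_in c X \<longrightarrow> smooth_in c Y \<longrightarrow> smooth_in c Z \<longrightarrow>
       (\<forall>p\<in>cdom c.
          dif c (\<lambda>q. \<omega> c q (Y q) (Z q)) p (X p)
          - dif c (\<lambda>q. \<omega> c q (X q) (Z q)) p (Y p)
          + dif c (\<lambda>q. \<omega> c q (X q) (Y q)) p (Z p)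
          - \<omega> c p (bracket c X Y p) (Z p)
          + \<omega> c p (bracket c X Z p) (Y p)
          - \<omega> c p (bracket c Y Z p) (X p) = 0))"

definition pseudo_riemannian :: "('m, 'n::finite) chart set \<Rightarrow> ('m, 'n) form2 \<Rightarrow> bool" where
  "pseudo_riemannian A g \<longleftrightarrow> bilinear_form A g \<and>
     (\<forall>c\<in>A. \<forall>p\<in>cdom c. \<forall>u v. g c p u v = g c p v u) \<and>
     (\<forall>c\<in>A. \<forall>p\<in>cdom c. \<forall>u. (\<forall>v. g c p u v = 0) \<longrightarrow> u = 0)"

section \<open>Special Kaehler manifolds\<close>

definition almost_complex :: "('m, 'n::finite) chart set \<Rightarrow> ('m, 'n) endo \<Rightarrow> bool" where
  "almost_complex A J \<longleftrightarrow> endo_field A J \<and> (\<forall>c\<in>A. \<forall>p\<in>cdom c. \<forall>v. J c p (J c p v) = - v)"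

text \<open>Integrability: around every point there is a holomorphic chart, that is, a chart \<open>d\<close> of the
  smooth structure with values in a complex vector space \<open>(real ^ 'n, J0)\<close> whose differential
  intertwines \<open>J\<close> with the multiplication \<open>J0\<close> by the imaginary unit.  Since all linear
  complex structures on \<open>real ^ 'n\<close> are conjugate, it does not matter that \<open>J0\<close> may depend on the
  chart.\<close>

definition complex_structure ::
  "('m::{t2_space, second_countable_topology}, 'n::finite) chart set \<Rightarrow> ('m, 'n) endo \<Rightarrow> bool"
  where
  "complex_structure A J \<longleftrightarrow> almost_complex A J \<and>
     (\<forall>p. \<exists>d J0. p \<in> cdom d \<and> smooth_atlas (insert d A) \<and>
        linear J0 \<and> (\<forall>v. J0 (J0 v) = - v) \<and>
        (\<forall>c\<in>A. \<forall>q\<in>cdom c \<inter> cdom d. \<forall>v.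
           dif c (cmap d) q (J c q v) = J0 (dif c (cmap d) q v)))"

definition hermitian ::
  "('m, 'n::finite) chart set \<Rightarrow> ('m, 'n) endo \<Rightarrow> ('m, 'n) form2 \<Rightarrow> bool" where
  "hermitian A J g \<longleftrightarrow> (\<forall>c\<in>A. \<forall>p\<in>cdom c. \<forall>u v. g c p (J c p u) (J c p v) = g c p u v)"

definition kaehler_form :: "('m, 'n::finite) endo \<Rightarrow> ('m, 'n) form2 \<Rightarrow> ('m, 'n) form2" where
  "kaehler_form J g = (\<lambda>c p u v. g c p u (J c p v))"

definition kaehler ::
  "('m::{t2_space, second_countable_topology}, 'n::finite) chart set \<Rightarrow>
    ('m, 'n) endo \<Rightarrow> ('m, 'n) form2 \<Rightarrow> bool" where
  "kaehler A J g \<longleftrightarrow> complex_structure A J \<and> pseudo_riemannian A g \<and> hermitian A J g \<and>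
     closed2 A (kaehler_form J g)"

text \<open>\<open>(\<nabla>\<^sub>X J) Y\<close>\<close>

definition cov_endo :: "('m, 'n::finite) conn \<Rightarrow> ('m, 'n) endo \<Rightarrow> ('m, 'n) chart \<Rightarrow>
    ('m \<Rightarrow> real ^ 'n) \<Rightarrow> ('m \<Rightarrow> real ^ 'n) \<Rightarrow> 'm \<Rightarrow> real ^ 'n" where
  "cov_endo \<Gamma> J c X Y p = cov \<Gamma> c X (\<lambda>q. J c q (Y q)) p - J c p (cov \<Gamma> c X Y p)"

definition special_kaehler ::
  "('m::{t2_space, second_countable_topology}, 'n::finite) chart set \<Rightarrow>
    ('m, 'n) endo \<Rightarrow> ('m, 'n) conn \<Rightarrow> ('m, 'n) form2 \<Rightarrow> bool" where
  "special_kaehler A J \<Gamma> g \<longleftrightarrow> kaehler A J g \<and>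
     connection A \<Gamma> \<and> torsion_free A \<Gamma> \<and> flat A \<Gamma> \<and>
     parallel2 A \<Gamma> (kaehler_form J g) \<and>
     (\<forall>c\<in>A. \<forall>X Y. smooth_in c X \<longrightarrow> smooth_in c Y \<longrightarrow>
        (\<forall>p\<in>cdom c. cov_endo \<Gamma> J c X Y p - cov_endo \<Gamma> J c Y X p = 0))"

section \<open>Affine immersions and parabolic spheres\<close>

text \<open>The ambient space of dimension \<open>n + 1\<close> is \<open>real ^ 'n option\<close>.\<close>

definition immersion ::
  "('m, 'n::finite) chart set \<Rightarrow> ('m \<Rightarrow> real ^ 'n option) \<Rightarrow> bool" where
  "immersion A \<phi> \<longleftrightarrow> (\<forall>c\<in>A. smooth_in c \<phi> \<and> (\<forall>p\<in>cdom c. inj (dif c \<phi> p)))"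

definition transversal_field ::
  "('m, 'n::finite) chart set \<Rightarrow> ('m \<Rightarrow> real ^ 'n option) \<Rightarrow> ('m \<Rightarrow> real ^ 'n option) \<Rightarrow> bool" where
  "transversal_field A \<phi> \<xi> \<longleftrightarrow>
     (\<forall>c\<in>A. smooth_in c \<xi> \<and> (\<forall>p\<in>cdom c. \<xi> p \<notin> range (dif c \<phi> p)))"

text \<open>\<open>\<Gamma>\<close>, \<open>g\<close>, \<open>S\<close>, \<open>\<tau>\<close> are the data induced by \<open>\<phi>\<close> and \<open>\<xi>\<close> through the formulas of Gauss and
  Weingarten.\<close>

definition induced_data ::
  "('m, 'n::finite) chart set \<Rightarrow> ('m \<Rightarrow> real ^ 'n option) \<Rightarrow> ('m \<Rightarrow> real ^ 'n option) \<Rightarrow>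
    ('m, 'n) conn \<Rightarrow> ('m, 'n) form2 \<Rightarrow> ('m, 'n) endo \<Rightarrow> ('m, 'n) form1 \<Rightarrow> bool" where
  "induced_data A \<phi> \<xi> \<Gamma> g S \<tau> \<longleftrightarrow>
     connection A \<Gamma> \<and> bilinear_form A g \<and> endo_field A S \<and> one_form A \<tau> \<and>
     (\<forall>c\<in>A. \<forall>X Y. smooth_in c X \<longrightarrow> smooth_in c Y \<longrightarrow>
        (\<forall>p\<in>cdom c. dif c (\<lambda>q. dif c \<phi> q (Y q)) p (X p) =
           dif c \<phi> p (cov \<Gamma> c X Y p) + g c p (X p) (Y p) *\<^sub>R \<xi> p)) \<and>
     (\<forall>c\<in>A. \<forall>X. smooth_in c X \<longrightarrow>
        (\<forall>p\<in>cdom c. dif c \<xi> p (X p) = - dif c \<phi> p (S c p (X p)) + \<tau> c p (X p) *\<^sub>R \<xi> p))"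

definition induced_vol ::
  "('m \<Rightarrow> real ^ 'n::finite option) \<Rightarrow> ('m \<Rightarrow> real ^ 'n option) \<Rightarrow> ('m, 'n) formn" where
  "induced_vol \<phi> \<xi> = (\<lambda>c p X. det (\<chi> k. case k of None \<Rightarrow> \<xi> p | Some i \<Rightarrow> dif c \<phi> p (X i)))"

text \<open>An orientation assigns to a chart \<open>c\<close> and a point \<open>p\<close> the sign of the coordinate frame of \<open>c\<close>
  at \<open>p\<close>; a frame \<open>X\<close> with components in \<open>c\<close> is positive iff \<open>ori c p * det (\<chi> i. X i) > 0\<close>.\<close>

definition orientation ::
  "('m::topological_space, 'n::finite) chart set \<Rightarrow> (('m, 'n) chart \<Rightarrow> 'm \<Rightarrow> real) \<Rightarrow> bool" where
  "orientation A ori \<longleftrightarrow>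
     (\<forall>c\<in>A. continuous_on (cdom c) (ori c) \<and> (\<forall>p\<in>cdom c. ori c p \<in> {-1, 1})) \<and>
     (\<forall>c\<in>A. \<forall>d\<in>A. \<forall>p\<in>cdom c \<inter> cdom d.
        ori c p = sgn (det (matrix (dif c (cmap d) p))) * ori d p)"

definition metric_vol ::
  "('m, 'n::finite) form2 \<Rightarrow> (('m, 'n) chart \<Rightarrow> 'm \<Rightarrow> real) \<Rightarrow> ('m, 'n) formn" where
  "metric_vol g ori = (\<lambda>c p X. ori c p * sgn (det (\<chi> i. X i)) *
     sqrt \<bar>det (\<chi> i j. g c p (X i) (X j))\<bar>)"

definition blaschke_immersion ::
  "('m::{t2_space, second_countable_topology}, 'n::finite) chart set \<Rightarrow>
    ('m \<Rightarrow> real ^ 'n option) \<Rightarrow> ('m \<Rightarrow> real ^ 'n option) \<Rightarrow>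
    ('m, 'n) conn \<Rightarrow> ('m, 'n) form2 \<Rightarrow> ('m, 'n) endo \<Rightarrow> ('m, 'n) form1 \<Rightarrow> bool" where
  "blaschke_immersion A \<phi> \<xi> \<Gamma> g S \<tau> \<longleftrightarrow>
     immersion A \<phi> \<and> transversal_field A \<phi> \<xi> \<and> induced_data A \<phi> \<xi> \<Gamma> g S \<tau> \<and>
     pseudo_riemannian A g \<and>
     (\<exists>ori. orientation A ori \<and> parallel_vol A \<Gamma> (metric_vol g ori) \<and>
        (\<forall>c\<in>A. \<forall>p\<in>cdom c. \<forall>X. metric_vol g ori c p X = induced_vol \<phi> \<xi> c p X))"

definition affine_hypersphere ::
  "('m::{t2_space, second_countable_topology}, 'n::finite) chart set \<Rightarrow>
    ('m \<Rightarrow> real ^ 'n option) \<Rightarrow> ('m \<Rightarrow> real ^ 'n option) \<Rightarrow>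
    ('m, 'n) conn \<Rightarrow> ('m, 'n) form2 \<Rightarrow> real \<Rightarrow> bool" where
  "affine_hypersphere A \<phi> \<xi> \<Gamma> g r \<longleftrightarrow>
     (\<exists>S \<tau>. blaschke_immersion A \<phi> \<xi> \<Gamma> g S \<tau> \<and>
        (\<forall>c\<in>A. \<forall>p\<in>cdom c. \<forall>v. S c p v = r *\<^sub>R v))"

definition parabolic_sphere ::
  "('m::{t2_space, second_countable_topology}, 'n::finite) chart set \<Rightarrow>
    ('m \<Rightarrow> real ^ 'n option) \<Rightarrow> ('m \<Rightarrow> real ^ 'n option) \<Rightarrow>
    ('m, 'n) conn \<Rightarrow> ('m, 'n) form2 \<Rightarrow> bool" where
  "parabolic_sphere A \<phi> \<xi> \<Gamma> g \<longleftrightarrow> affine_hypersphere A \<phi> \<xi> \<Gamma> g 0"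

definition special_parabolic ::
  "('m, 'n::finite) chart set \<Rightarrow> ('m, 'n) conn \<Rightarrow> ('m, 'n) form2 \<Rightarrow> bool" where
  "special_parabolic A \<Gamma> g \<longleftrightarrow>
     (\<exists>J. almost_complex A J \<and> hermitian A J g \<and> parallel2 A \<Gamma> (\<lambda>c p u v. g c p (J c p u) v))"

end

theory Submission
  imports Defs
begin

text \<open>
  Since the shape tensor vanishes and the induced volume form is parallel, the affine normal \<open>\<xi>\<close> is
  locally constant.  Differentiating the Gauss formula once more and antisymmetrizing, the tangential
  part says that \<open>\<nabla>\<close> is flat and the transversal part that \<open>\<nabla>g\<close> is totally symmetric.  If
  \<open>\<omega> = g(J\<cdot>,\<cdot>)\<close> is parallel, then \<open>(\<nabla>\<^sub>X g)(Y, Z) = -\<omega>((\<nabla>\<^sub>X J) Y, Z)\<close>, so the symmetry of \<open>\<nabla>g\<close>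
  is the equation \<open>d\<^sup>\<nabla> J = 0\<close>, while \<open>d\<omega> = 0\<close> because \<open>\<nabla>\<close> is torsion-free.

  Integrability of \<open>J\<close> needs no Newlander-Nirenberg theorem.  A linear projection \<open>\<pi>\<close> along \<open>\<xi>\<close> turns
  \<open>\<phi>\<close> into a flat coordinate system \<open>x = \<pi> \<circ> \<phi>\<close>; the equation \<open>d\<^sup>\<nabla> J = 0\<close> makes the vector valued
  1-form \<open>dx \<circ> J\<close> closed, so it has a local potential \<open>y\<close>.  With \<open>J\<^sub>0\<close> the value of \<open>J\<close> at a point, where
  \<open>\<pi>\<close> is normalized so that \<open>dx = id\<close>, the map \<open>x - J\<^sub>0 y\<close> has differential \<open>dx - J\<^sub>0 dx J\<close>, which
  intertwines \<open>J\<close> with \<open>J\<^sub>0\<close> and equals \<open>2 id\<close> at the point: it is a holomorphic chart.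
\<close>

section \<open>Calculus of k times differentiable maps\<close>

lemma Ck_on_subset: "Ck_on k S f \<Longrightarrow> T \<subseteq> S \<Longrightarrow> Ck_on k T f"
  by (induction k arbitrary: f) (auto intro: continuous_on_subset)

text \<open>Openness of \<open>S\<close> is the point: a derivative at a point of \<open>S\<close>
  sees a whole neighbourhood, on which the two maps agree.\<close>

lemma Ck_on_cong:
  assumes "open S" "\<And>x. x \<in> S \<Longrightarrow> f x = g x" "Ck_on k S f"
  shows "Ck_on k S g"
  using assms(2,3)
proof (induction k arbitrary: f g)
  case 0
  then show ?case by (auto cong: continuous_on_cong)
next
  case (Suc k)
  have f: "f differentiable (at x)" if "x \<in> S" for x
    using Suc.prems that by auto
  have fd: "frechet_derivative f (at x) = frechet_derivative g (at x)" if "x \<in> S" for x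
    using frechet_derivative_transform_within_open[OF f assms(1) that Suc.prems(1)] that by auto
  have "g differentiable (at x)" if "x \<in> S" for x
    using f[OF that] assms(1) that Suc.prems(1)
    unfolding differentiable_def by (metis has_derivative_transform_within_open)
  moreover have "Ck_on k S (\<lambda>x. frechet_derivative g (at x) v)" for v
    by (rule Suc.IH[of "\<lambda>x. frechet_derivative f (at x) v"]) (use Suc.prems fd in auto)
  ultimately show ?case by simp
qed

text \<open>\<open>Ck_on\<close> refers to the chosen \<open>frechet_derivative\<close>. By
  uniqueness of derivatives any explicit formula \<open>f'\<close> may take its place; the closure
  properties below rest on this rule.\<close>

lemma Ck_on_SucI:
  assumes "open S" "\<And>x. x \<in> S \<Longrightarrow> (f has_derivative f' x) (at x)"
    "\<And>v. Ck_on k S (\<lambda>x. f' x v)"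
  shows "Ck_on (Suc k) S f"
proof -
  have "f' x = frechet_derivative f (at x)" if "x \<in> S" for x
    using assms(2)[OF that] by (rule frechet_derivative_at)
  then have "Ck_on k S (\<lambda>x. frechet_derivative f (at x) v)" for v
    using Ck_on_cong[OF assms(1) _ assms(3)[of v]] by auto
  then show ?thesis using assms(2) by (auto simp: differentiable_def)
qed

lemma Ck_on_Suc_derivative:
  assumes "Ck_on (Suc k) S f" "x \<in> S"
  shows "(f has_derivative frechet_derivative f (at x)) (at x)"
  using assms by (simp add: frechet_derivative_works)

lemma Ck_on_Suc_imp: "Ck_on (Suc k) S f \<Longrightarrow> Ck_on k S f"
proof (induction k arbitrary: f)
  case 0
  then show ?case
    by (auto intro!: continuous_at_imp_continuous_on differentiable_imp_continuous_within)
next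
  case (Suc k)
  then show ?case by simp
qed

lemma Ck_on_const: "open S \<Longrightarrow> Ck_on k S (\<lambda>x. a)"
proof (induction k arbitrary: a)
  case (Suc k)
  show ?case by (rule Ck_on_SucI[where f' = "\<lambda>x v. 0"]) (use Suc in auto)
qed simp

lemma Ck_on_bounded_linear:
  assumes "open S" "bounded_linear L" "Ck_on k S f"
  shows "Ck_on k S (\<lambda>x. L (f x))"
  using assms(3)
proof (induction k arbitrary: f)
  case 0
  then show ?case using assms(2) by (auto intro: bounded_linear.continuous_on)
next
  case (Suc k)
  show ?case
    by (rule Ck_on_SucI[OF assms(1), where f' = "\<lambda>x v. L (frechet_derivative f (at x) v)"])
      (use Suc in \<open>auto intro!: bounded_linear.has_derivative[OF assms(2)] Ck_on_Suc_derivative[OF Suc.prems]\<close>)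
qed

lemma Ck_on_ident: "open S \<Longrightarrow> Ck_on k S (\<lambda>x. x)"
proof (cases k)
  case (Suc j)
  assume "open S"
  then show ?thesis unfolding Suc
    by (intro Ck_on_SucI[where f' = "\<lambda>x v. v"]) (auto intro: Ck_on_const)
qed auto

lemma Ck_on_add:
  assumes "open S" "Ck_on k S f" "Ck_on k S g"
  shows "Ck_on k S (\<lambda>x. f x + g x)"
  using assms(2,3)
proof (induction k arbitrary: f g)
  case 0
  then show ?case by (auto intro: continuous_intros)
next
  case (Suc k)
  show ?case
    by (rule Ck_on_SucI[OF assms(1), where
          f' = "\<lambda>x v. frechet_derivative f (at x) v + frechet_derivative g (at x) v"])
      (use Suc in \<open>auto intro!: has_derivative_add Ck_on_Suc_derivative[OF Suc.prems(1)]
          Ck_on_Suc_derivative[OF Suc.prems(2)]\<close>)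
qed

lemma Ck_on_bilinear:
  assumes "open S" "bounded_bilinear B" "Ck_on k S f" "Ck_on k S g"
  shows "Ck_on k S (\<lambda>x. B (f x) (g x))"
  using assms(3,4)
proof (induction k arbitrary: f g)
  case 0
  then show ?case by (auto intro: bounded_bilinear.continuous_on[OF assms(2)])
next
  case (Suc k)
  show ?case
    by (rule Ck_on_SucI[OF assms(1), where
          f' = "\<lambda>x v. B (f x) (frechet_derivative g (at x) v) + B (frechet_derivative f (at x) v) (g x)"])
      (use Suc.prems in \<open>auto intro!: bounded_bilinear.FDERIV[OF assms(2)] Ck_on_add[OF assms(1)]
          Suc.IH Ck_on_Suc_imp[OF Suc.prems(1)] Ck_on_Suc_imp[OF Suc.prems(2)]
          Ck_on_Suc_derivative[OF Suc.prems(1)] Ck_on_Suc_derivative[OF Suc.prems(2)]\<close>)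
qed

lemma Ck_on_sum:
  assumes "open S" "\<And>i. i \<in> I \<Longrightarrow> Ck_on k S (f i)"
  shows "Ck_on k S (\<lambda>x. \<Sum>i\<in>I. f i x)"
  using assms(2)
  by (induction I rule: infinite_finite_induct) (auto intro: Ck_on_const Ck_on_add assms(1))

lemma Ck_on_prod:
  fixes f :: "'i \<Rightarrow> 'a::euclidean_space \<Rightarrow> real"
  assumes "open S" "\<And>i. i \<in> I \<Longrightarrow> Ck_on k S (f i)"
  shows "Ck_on k S (\<lambda>x. \<Prod>i\<in>I. f i x)"
  using assms(2)
  by (induction I rule: infinite_finite_induct)
    (auto intro: Ck_on_const Ck_on_bilinear[OF _ bounded_bilinear_mult] assms(1))

text \<open>The derivative of the inverse is a product of inverses with the derivative of
  \<open>f\<close>, so regularity of the inverse at order \<open>k\<close> lifts itself to order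
  \<open>Suc k\<close>.\<close>

lemma Ck_on_inverse:
  fixes f :: "'a::euclidean_space \<Rightarrow> real"
  assumes "open S" "Ck_on k S f" "\<And>x. x \<in> S \<Longrightarrow> f x \<noteq> 0"
  shows "Ck_on k S (\<lambda>x. inverse (f x))"
  using assms(2)
proof (induction k)
  case 0
  then show ?case using assms(3) by (auto intro: continuous_intros)
next
  case (Suc k)
  note mult = Ck_on_bilinear[OF assms(1) bounded_bilinear_mult]
  have inv: "Ck_on k S (\<lambda>x. inverse (f x))" using Suc Ck_on_Suc_imp by blast
  have "Ck_on k S (\<lambda>x. - (inverse (f x) * frechet_derivative f (at x) v * inverse (f x)))" for v
    by (intro Ck_on_bounded_linear[OF assms(1) bounded_linear_minus[OF bounded_linear_ident]] mult inv)
      (use Suc.prems in auto)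
  then show ?case
    by (intro Ck_on_SucI[OF assms(1), where
          f' = "\<lambda>x v. - (inverse (f x) * frechet_derivative f (at x) v * inverse (f x))"])
      (auto intro!: Deriv.has_derivative_inverse Ck_on_Suc_derivative[OF Suc.prems] assms(3))
qed

lemma Ck_on_componentwise:
  fixes f :: "'a::euclidean_space \<Rightarrow> 'b::euclidean_space"
  assumes "open S" "\<And>b. b \<in> Basis \<Longrightarrow> Ck_on k S (\<lambda>x. f x \<bullet> b)"
  shows "Ck_on k S f"
proof -
  have "Ck_on k S (\<lambda>x. \<Sum>b\<in>Basis. (f x \<bullet> b) *\<^sub>R b)"
    by (intro Ck_on_sum Ck_on_bilinear[OF _ bounded_bilinear_scaleR] Ck_on_const assms)
  then show ?thesis by (simp add: euclidean_representation)
qed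

text \<open>Separates the coefficients of the argument from the values of \<open>L\<close> on fixed
  vectors. Regularity of tensor fields is assumed on fixed vectors, so this expansion is used
  whenever the argument varies.\<close>

lemma linear_euclidean_expand:
  fixes v :: "'a::euclidean_space"
  assumes "linear L"
  shows "L v = (\<Sum>b\<in>Basis. (v \<bullet> b) *\<^sub>R L b)"
proof -
  have "L v = L (\<Sum>b\<in>Basis. (v \<bullet> b) *\<^sub>R b)" by (simp add: euclidean_representation)
  then show ?thesis using assms by (simp add: linear_sum linear_cmul)
qed

text \<open>The chain rule evaluates the derivative of \<open>h\<close> in a direction that moves
  with \<open>x\<close>, while \<open>Ck_on\<close> controls fixed directions. Expanding that
  direction in the basis leaves derivatives of \<open>h\<close> composed with \<open>f\<close>, to
  which the induction hypothesis for arbitrary \<open>h\<close> applies.\<close>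

lemma Ck_on_compose:
  fixes f :: "'a::euclidean_space \<Rightarrow> 'b::euclidean_space" and h :: "'b \<Rightarrow> 'c::real_normed_vector"
  assumes "open S" "open T" "f ` S \<subseteq> T" "Ck_on k S f" "Ck_on k T h"
  shows "Ck_on k S (\<lambda>x. h (f x))"
  using assms(4,5)
proof (induction k arbitrary: h)
  case 0
  then show ?case using assms(3) by (auto intro: continuous_on_compose2)
next
  case (Suc k)
  let ?f = "\<lambda>x. frechet_derivative f (at x)" and ?h = "\<lambda>x. frechet_derivative h (at x)"
  have eq: "?h (f x) (?f x v) = (\<Sum>b\<in>Basis. (?f x v \<bullet> b) *\<^sub>R ?h (f x) b)" if "x \<in> S" for x v
    by (rule linear_euclidean_expand) (use that Suc.prems assms(3) in \<open>auto intro!: linear_frechet_derivative\<close>)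
  have "Ck_on k S (\<lambda>x. \<Sum>b\<in>Basis. (?f x v \<bullet> b) *\<^sub>R ?h (f x) b)" for v
    using Suc.prems
    by (intro Ck_on_sum[OF assms(1)] Ck_on_bilinear[OF assms(1) bounded_bilinear_scaleR] Suc.IH
        Ck_on_bounded_linear[OF assms(1) bounded_linear_inner_left] Ck_on_Suc_imp[OF Suc.prems(1)]) auto
  then have "Ck_on k S (\<lambda>x. ?h (f x) (?f x v))" for v
    by (rule Ck_on_cong[OF assms(1), rotated]) (simp add: eq)
  moreover have "((\<lambda>x. h (f x)) has_derivative (\<lambda>v. ?h (f x) (?f x v))) (at x)" if "x \<in> S" for x
    by (rule has_derivative_compose[of f "?f x" x UNIV h "?h (f x)"])
      (use that assms(3) in \<open>auto intro!: Ck_on_Suc_derivative[OF Suc.prems(1)] Ck_on_Suc_derivative[OF Suc.prems(2)]\<close>)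
  ultimately show ?case
    by (intro Ck_on_SucI[OF assms(1)])
qed

section \<open>Determinants and smoothness of local inverses\<close>

lemma Ck_on_det:
  fixes M :: "'a::euclidean_space \<Rightarrow> real ^ 'n ^ 'n"
  assumes "open S" "\<And>i j. Ck_on k S (\<lambda>x. M x $ i $ j)"
  shows "Ck_on k S (\<lambda>x. det (M x))"
  unfolding det_def
  by (intro Ck_on_sum Ck_on_bilinear[OF _ bounded_bilinear_mult] Ck_on_prod Ck_on_const assms)

text \<open>Bootstrapping: the derivative of \<open>g\<close> at \<open>y\<close> inverts that of
  \<open>f\<close> at \<open>g y\<close>, and by Cramer's rule its entries are rational in the
  entries of the latter. If \<open>g\<close> is of order \<open>k\<close>, so are these entries, and
  \<open>g\<close> is of order \<open>Suc k\<close>.\<close>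

lemma Ck_on_local_inverse:
  fixes f :: "real ^ 'n \<Rightarrow> real ^ 'n"
  assumes "open U" "open V" "homeomorphism U V f g" "smooth_on U f"
    and g: "\<And>y. y \<in> V \<Longrightarrow> (g has_derivative g' y) (at y)"
    and g': "\<And>y v. y \<in> V \<Longrightarrow> frechet_derivative f (at (g y)) (g' y v) = v"
  shows "Ck_on k V g"
proof (induction k)
  case 0
  then show ?case using assms(3) by (simp add: homeomorphism_def)
next
  case (Suc k)
  have gV: "g ` V \<subseteq> U" using assms(3) by (auto simp: homeomorphism_def)
  define M where "M y = matrix (frechet_derivative f (at (g y)))" for y
  have lin: "linear (frechet_derivative f (at (g y)))" if "y \<in> V" for y
    using assms(4) gV that unfolding smooth_on_def
    by (intro linear_frechet_derivative) (metis Ck_on.simps(2) image_subset_iff)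
  have Mg: "M y *v g' y v = v" if "y \<in> V" for y v
    unfolding M_def using that g' lin by (simp add: matrix_works)
  have "det (M y) \<noteq> 0" if "y \<in> V" for y
  proof -
    have "linear (g' y)" using g[OF that] has_derivative_linear by blast
    then have "M y ** matrix (g' y) = mat 1"
      using Mg[OF that] by (simp add: matrix_eq matrix_works flip: matrix_vector_mul_assoc)
    then show ?thesis using invertible_det_nz invertible_right_inverse by blast
  qed note dnz = this
  have MC: "Ck_on k V (\<lambda>y. M y $ i $ j)" for i j
  proof -
    have "Ck_on k U (\<lambda>x. frechet_derivative f (at x) (axis j 1))"
      using assms(4) unfolding smooth_on_def by (metis Ck_on.simps(2))
    from Ck_on_compose[OF assms(2,1) gV Suc this]
    have "Ck_on k V (\<lambda>y. frechet_derivative f (at (g y)) (axis j 1) $ i)"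
      by (rule Ck_on_bounded_linear[OF assms(2) bounded_linear_vec_nth])
    then show ?thesis by (simp add: M_def matrix_def)
  qed
  have eq: "g' y v \<bullet> axis m 1 = det (\<chi> i j. if j = m then v $ i else M y $ i $ j) * inverse (det (M y))"
    if "y \<in> V" for y v m
    using iffD1[OF cramer[OF dnz[OF that]] Mg[OF that]]
    by (simp add: inner_axis divide_inverse)
  have "Ck_on k V (\<lambda>y. g' y v)" for v
  proof (rule Ck_on_componentwise[OF assms(2)])
    fix b :: "real ^ 'n" assume "b \<in> Basis"
    then obtain m where b: "b = axis m 1" by (auto simp: Basis_vec_def)
    have "Ck_on k V (\<lambda>y. (\<chi> i j. if j = m then v $ i else M y $ i $ j) $ i $ j)" for i j
      using MC by (cases "j = m") (auto intro: Ck_on_const assms(2))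
    then have "Ck_on k V (\<lambda>y. det (\<chi> i j. if j = m then v $ i else M y $ i $ j) * inverse (det (M y)))"
      by (intro Ck_on_bilinear[OF assms(2) bounded_bilinear_mult] Ck_on_det assms(2) Ck_on_inverse dnz MC)
    then show "Ck_on k V (\<lambda>y. g' y v \<bullet> b)"
      by (rule Ck_on_cong[OF assms(2), rotated]) (simp add: eq b)
  qed
  then show ?case using g by (intro Ck_on_SucI[OF assms(2)])
qed

lemma smooth_on_compose:
  fixes f :: "'a::euclidean_space \<Rightarrow> 'b::euclidean_space" and h :: "'b \<Rightarrow> 'c::real_normed_vector"
  assumes "open S" "open T" "f ` S \<subseteq> T" "smooth_on S f" "smooth_on T h"
  shows "smooth_on S (\<lambda>x. h (f x))"
  using assms(4,5) Ck_on_compose[OF assms(1-3)] by (auto simp: smooth_on_def)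

lemma smooth_on_cong:
  "open S \<Longrightarrow> (\<And>x. x \<in> S \<Longrightarrow> f x = g x) \<Longrightarrow> smooth_on S f \<Longrightarrow> smooth_on S g"
  unfolding smooth_on_def using Ck_on_cong by blast

lemma smooth_on_subset: "smooth_on S f \<Longrightarrow> T \<subseteq> S \<Longrightarrow> smooth_on T f"
  unfolding smooth_on_def using Ck_on_subset by blast

lemma smooth_on_differentiable: "smooth_on S f \<Longrightarrow> x \<in> S \<Longrightarrow> f differentiable (at x)"
  unfolding smooth_on_def by (metis Ck_on.simps(2))

section \<open>Symmetry of second derivatives and closed 1-forms\<close>

lemma DERIV_along_line:
  fixes f :: "'a::real_normed_vector \<Rightarrow> real"
  assumes "(f has_derivative f') (at (a + s *\<^sub>R u))"
  shows "((\<lambda>s. f (a + s *\<^sub>R u)) has_real_derivative f' u) (at s)"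
proof -
  have "((\<lambda>s. f (a + s *\<^sub>R u)) has_derivative (\<lambda>r. f' (r *\<^sub>R u))) (at s)"
    by (rule has_derivative_compose[of "\<lambda>s. a + s *\<^sub>R u" "\<lambda>r. r *\<^sub>R u" s UNIV f f'])
      (use assms in \<open>auto intro!: derivative_eq_intros\<close>)
  moreover have "f' (r *\<^sub>R u) = f' u * r" for r
    using linear_cmul[OF has_derivative_linear[OF assms]] by simp
  ultimately show ?thesis by (simp add: has_field_derivative_def)
qed

text \<open>Two applications of the mean value theorem: first in the direction \<open>u\<close>, to
  the difference of \<open>f\<close> along two parallel segments, then in the direction
  \<open>v\<close>, to the derivative of \<open>f\<close> in the direction \<open>u\<close>.\<close>

lemma second_difference_mean_value:
  fixes f :: "'a::euclidean_space \<Rightarrow> real"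
  assumes C2: "Ck_on 2 S f" and h: "h > 0"
    and in_S: "\<And>s t. 0 \<le> s \<Longrightarrow> s \<le> h \<Longrightarrow> 0 \<le> t \<Longrightarrow> t \<le> h \<Longrightarrow> x + s *\<^sub>R u + t *\<^sub>R v \<in> S"
  shows "\<exists>s t. 0 < s \<and> s < h \<and> 0 < t \<and> t < h \<and>
    f (x + h *\<^sub>R u + h *\<^sub>R v) - f (x + h *\<^sub>R u) - f (x + h *\<^sub>R v) + f x =
    h * h * frechet_derivative (\<lambda>y. frechet_derivative f (at y) u) (at (x + s *\<^sub>R u + t *\<^sub>R v)) v"
proof -
  let ?Du = "\<lambda>y. frechet_derivative f (at y) u"
  have f: "(f has_derivative frechet_derivative f (at y)) (at y)" if "y \<in> S" for y
    using C2 that by (simp add: numeral_2_eq_2 frechet_derivative_works)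
  have Du: "(?Du has_derivative frechet_derivative ?Du (at y)) (at y)" if "y \<in> S" for y
    using C2 that by (simp add: numeral_2_eq_2 frechet_derivative_works)
  have "\<exists>s. 0 < s \<and> s < h \<and> (f (x + h *\<^sub>R v + h *\<^sub>R u) - f (x + h *\<^sub>R u)) - (f (x + h *\<^sub>R v + 0 *\<^sub>R u) - f (x + 0 *\<^sub>R u)) =
      (h - 0) * (?Du (x + h *\<^sub>R v + s *\<^sub>R u) - ?Du (x + s *\<^sub>R u))"
  proof (rule MVT2[OF h])
    fix s assume s: "0 \<le> s" "s \<le> h"
    show "((\<lambda>s. f (x + h *\<^sub>R v + s *\<^sub>R u) - f (x + s *\<^sub>R u)) has_real_derivative
        ?Du (x + h *\<^sub>R v + s *\<^sub>R u) - ?Du (x + s *\<^sub>R u)) (at s)"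
      using in_S[of s h] in_S[of s 0] s h
      by (intro derivative_intros DERIV_along_line f) (auto simp: algebra_simps)
  qed
  then obtain s where s: "0 < s" "s < h"
    and eq1: "f (x + h *\<^sub>R v + h *\<^sub>R u) - f (x + h *\<^sub>R u) - (f (x + h *\<^sub>R v) - f x) =
      h * (?Du (x + h *\<^sub>R v + s *\<^sub>R u) - ?Du (x + s *\<^sub>R u))" by auto
  let ?DDu = "\<lambda>t. frechet_derivative ?Du (at (x + s *\<^sub>R u + t *\<^sub>R v)) v"
  have "\<exists>t. 0 < t \<and> t < h \<and> ?Du (x + s *\<^sub>R u + h *\<^sub>R v) - ?Du (x + s *\<^sub>R u + 0 *\<^sub>R v) =
      (h - 0) * ?DDu t"
    by (rule MVT2[OF h], rule DERIV_along_line, rule Du, rule in_S) (use s in auto)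
  then obtain t where t: "0 < t" "t < h"
    and eq2: "?Du (x + s *\<^sub>R u + h *\<^sub>R v) - ?Du (x + s *\<^sub>R u) =
      h * frechet_derivative ?Du (at (x + s *\<^sub>R u + t *\<^sub>R v)) v" by auto
  have "x + h *\<^sub>R u + h *\<^sub>R v = x + h *\<^sub>R v + h *\<^sub>R u" "x + h *\<^sub>R v + s *\<^sub>R u = x + s *\<^sub>R u + h *\<^sub>R v"
    by (simp_all add: algebra_simps)
  then have "f (x + h *\<^sub>R u + h *\<^sub>R v) - f (x + h *\<^sub>R u) - f (x + h *\<^sub>R v) + f x =
    h * (h * frechet_derivative ?Du (at (x + s *\<^sub>R u + t *\<^sub>R v)) v)"
    using eq1 eq2 by (simp only:)
  then show ?thesis using s t by (metis mult.assoc)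
qed

text \<open>The second difference over a parallelogram with sides parallel to \<open>u\<close> and
  \<open>v\<close> is symmetric in \<open>u\<close> and \<open>v\<close>. Its two evaluations give
  equal values of both mixed derivatives at points near \<open>x\<close>, and continuity moves these
  points to \<open>x\<close>.\<close>

lemma second_derivative_commute_real:
  fixes f :: "'a::euclidean_space \<Rightarrow> real"
  assumes "open S" "x \<in> S" and C2: "Ck_on 2 S f"
  shows "frechet_derivative (\<lambda>y. frechet_derivative f (at y) u) (at x) v =
    frechet_derivative (\<lambda>y. frechet_derivative f (at y) v) (at x) u"
proof (rule ccontr)
  let ?D = "\<lambda>u v y. frechet_derivative (\<lambda>y. frechet_derivative f (at y) u) (at y) v"
  \<comment> \<open>Half the supposed gap: two equal numbers within \<open>e\<close> of the two
    sides would bring the sides closer than \<open>2 * e\<close>.\<close>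
  define e where "e = dist (?D u v x) (?D v u x) / 2"
  assume "\<not> ?thesis"
  then have e: "e > 0" by (simp add: e_def)
  have cont: "isCont (?D u v) x" for u v
    using C2 assms(1,2) by (simp add: numeral_2_eq_2 continuous_on_eq_continuous_at)
  obtain d1 where d1: "d1 > 0" "\<And>y. dist y x < d1 \<Longrightarrow> dist (?D u v y) (?D u v x) < e"
    using cont[of u v] e unfolding continuous_at_eps_delta by blast
  obtain d2 where d2: "d2 > 0" "\<And>y. dist y x < d2 \<Longrightarrow> dist (?D v u y) (?D v u x) < e"
    using cont[of v u] e unfolding continuous_at_eps_delta by blast
  obtain d3 where d3: "d3 > 0" "ball x d3 \<subseteq> S" using assms(1,2) openE by blast
  define d where "d = min d1 (min d2 d3)"
  \<comment> \<open>The parallelogram then stays in the ball of radius \<open>d\<close>; the summand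
    1 keeps the denominator positive when \<open>u\<close> and \<open>v\<close> both vanish.\<close>
  define h where "h = d / (2 * (norm u + norm v + 1))"
  have d: "d > 0" using d1 d2 d3 by (simp add: d_def)
  have nuv: "norm u + norm v + 1 > 0" by (smt (verit) norm_ge_zero)
  have h: "h > 0" unfolding h_def using d nuv by simp
  have hd: "h * (norm u + norm v) < d"
  proof -
    have "h * (norm u + norm v) \<le> h * (norm u + norm v + 1)" using h by simp
    also have "\<dots> = d / 2"
    proof -
      have "d / (2 * N) * N = d / 2" if "N > 0" for N :: real using that by simp
      from this[OF nuv] show ?thesis by (simp only: h_def)
    qed
    finally show ?thesis using d by simp
  qed
  have near: "dist (x + s *\<^sub>R a + t *\<^sub>R b) x < d"
    if "0 \<le> s" "s \<le> h" "0 \<le> t" "t \<le> h" "norm a + norm b = norm u + norm v" for s t a b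
  proof -
    have "norm (s *\<^sub>R a + t *\<^sub>R b) \<le> s * norm a + t * norm b"
      using that by (intro norm_triangle_le) simp
    also have "\<dots> \<le> h * norm a + h * norm b"
      using that by (intro add_mono mult_right_mono) auto
    also have "\<dots> < d" using hd that(5) by (simp flip: distrib_left)
    finally show ?thesis by (simp add: dist_norm algebra_simps)
  qed
  have in_S: "x + s *\<^sub>R a + t *\<^sub>R b \<in> S"
    if "0 \<le> s" "s \<le> h" "0 \<le> t" "t \<le> h" "norm a + norm b = norm u + norm v" for s t a b
    using near[OF that] d3 by (auto simp: d_def dist_commute)
  obtain s t where st: "0 < s" "s < h" "0 < t" "t < h" and
    1: "f (x + h *\<^sub>R u + h *\<^sub>R v) - f (x + h *\<^sub>R u) - f (x + h *\<^sub>R v) + f x = h * h * ?D u v (x + s *\<^sub>R u + t *\<^sub>R v)"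
    using second_difference_mean_value[OF C2 h, of x u v] in_S by blast
  obtain s' t' where st': "0 < s'" "s' < h" "0 < t'" "t' < h" and
    2: "f (x + h *\<^sub>R v + h *\<^sub>R u) - f (x + h *\<^sub>R v) - f (x + h *\<^sub>R u) + f x = h * h * ?D v u (x + s' *\<^sub>R v + t' *\<^sub>R u)"
    using second_difference_mean_value[OF C2 h, of x v u] in_S[of _ _ v u] by (metis add.commute)
  have "f (x + h *\<^sub>R u + h *\<^sub>R v) = f (x + h *\<^sub>R v + h *\<^sub>R u)" by (simp add: algebra_simps)
  then have "h * h * ?D u v (x + s *\<^sub>R u + t *\<^sub>R v) = h * h * ?D v u (x + s' *\<^sub>R v + t' *\<^sub>R u)"
    using 1 2 by linarith
  then have "?D u v (x + s *\<^sub>R u + t *\<^sub>R v) = ?D v u (x + s' *\<^sub>R v + t' *\<^sub>R u)"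
    using h by simp
  moreover have "dist (?D u v (x + s *\<^sub>R u + t *\<^sub>R v)) (?D u v x) < e"
    using near[of s t u v] st by (intro d1) (auto simp: d_def)
  moreover have "dist (?D v u (x + s' *\<^sub>R v + t' *\<^sub>R u)) (?D v u x) < e"
    using near[of s' t' v u] st' by (intro d2) (auto simp: d_def)
  ultimately have "dist (?D u v x) (?D v u x) < 2 * e"
    unfolding dist_real_def by linarith
  then show False by (simp add: e_def)
qed

lemma second_derivative_commute:
  fixes f :: "'a::euclidean_space \<Rightarrow> 'b::euclidean_space"
  assumes "open S" "x \<in> S" and C2: "Ck_on 2 S f"
  shows "frechet_derivative (\<lambda>y. frechet_derivative f (at y) u) (at x) v =
    frechet_derivative (\<lambda>y. frechet_derivative f (at y) v) (at x) u"
proof (rule euclidean_eqI)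
  fix b :: 'b assume "b \<in> Basis"
  have comp: "frechet_derivative (\<lambda>y. F y \<bullet> b) (at y) w = frechet_derivative F (at y) w \<bullet> b"
    if "Ck_on (Suc k) S F" "y \<in> S" for F :: "'a \<Rightarrow> 'b" and y w k
    using frechet_derivative_at[OF has_derivative_inner_left[OF Ck_on_Suc_derivative[OF that]]]
    by metis
  have 2: "frechet_derivative (\<lambda>y. frechet_derivative (\<lambda>y. f y \<bullet> b) (at y) w) (at x) w' =
      frechet_derivative (\<lambda>y. frechet_derivative f (at y) w) (at x) w' \<bullet> b" for w w'
  proof -
    have D: "Ck_on (Suc 0) S (\<lambda>y. frechet_derivative f (at y) w)"
      using C2 by (simp add: numeral_2_eq_2)
    have "(\<lambda>y. frechet_derivative f (at y) w \<bullet> b) differentiable (at x)"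
      using has_derivative_inner_left[OF Ck_on_Suc_derivative[OF D assms(2)]]
      unfolding differentiable_def by blast
    from frechet_derivative_transform_within_open[OF this assms(1,2)]
    have "frechet_derivative (\<lambda>y. frechet_derivative (\<lambda>y. f y \<bullet> b) (at y) w) (at x) =
      frechet_derivative (\<lambda>y. frechet_derivative f (at y) w \<bullet> b) (at x)"
      using comp[OF C2[unfolded numeral_2_eq_2]] by metis
    then show ?thesis using comp[OF D assms(2)] by simp
  qed
  have "Ck_on 2 S (\<lambda>y. f y \<bullet> b)"
    by (rule Ck_on_bounded_linear[OF assms(1) bounded_linear_inner_left C2])
  from second_derivative_commute_real[OF assms(1,2) this, of u v] 
  show "frechet_derivative (\<lambda>y. frechet_derivative f (at y) u) (at x) v \<bullet> b =
    frechet_derivative (\<lambda>y. frechet_derivative f (at y) v) (at x) u \<bullet> b"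
    unfolding 2 .
qed

text \<open>The product rule differentiates one row at a time in each product over a permutation;
  exchanging the sums over permutations and rows collects, for each row, the determinant with that
  row replaced by its derivative.\<close>

lemma has_derivative_det:
  fixes M :: "'a::real_normed_vector \<Rightarrow> real ^ 'n ^ 'n"
  assumes "\<And>k. ((\<lambda>x. M x $ k) has_derivative M' k) (at x)"
  shows "((\<lambda>x. det (M x)) has_derivative
    (\<lambda>h. \<Sum>k\<in>UNIV. det (\<chi> i. if i = k then M' k h else M x $ i))) (at x)"
proof -
  let ?P = "{p. p permutes (UNIV :: 'n set)}"
  have "((\<lambda>x. det (M x)) has_derivative
      (\<lambda>h. \<Sum>p\<in>?P. of_int (sign p) * (\<Sum>k\<in>UNIV. M' k h $ p k * (\<Prod>j\<in>UNIV - {k}. M x $ j $ p j)))) (at x)"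
    unfolding det_def
    by (intro has_derivative_sum has_derivative_mult_right has_derivative_prod
        bounded_linear.has_derivative[OF bounded_linear_vec_nth] assms)
  moreover have "(\<Sum>p\<in>?P. of_int (sign p) * (\<Sum>k\<in>UNIV. M' k h $ p k * (\<Prod>j\<in>UNIV - {k}. M x $ j $ p j))) =
      (\<Sum>k\<in>UNIV. det (\<chi> i. if i = k then M' k h else M x $ i))" for h
  proof -
    have "(\<Prod>i\<in>UNIV. (\<chi> i. if i = k then M' k h else M x $ i) $ i $ p i) =
        M' k h $ p k * (\<Prod>j\<in>UNIV - {k}. M x $ j $ p j)" for k p
      by (subst prod.remove[of _ k]) (auto intro!: prod.cong)
    then show ?thesis
      unfolding det_def sum_distrib_left by (subst sum.swap) simp
  qed
  ultimately show ?thesis by simp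
qed

text \<open>Poincare lemma. The potential is the integral of \<open>\<alpha>\<close> along the
  segment from \<open>x0\<close>; it is differentiated under the integral sign, where closedness
  turns the integrand into a total derivative in the segment parameter.\<close>

lemma closed_1form_potential:
  fixes \<alpha> :: "'a::euclidean_space \<Rightarrow> 'a \<Rightarrow> 'b::euclidean_space"
  assumes "open B" "convex B" "x0 \<in> B"
    and lin: "\<And>x. x \<in> B \<Longrightarrow> linear (\<alpha> x)"
    and C1: "\<And>v. Ck_on 1 B (\<lambda>x. \<alpha> x v)"
    and closed: "\<And>x u v. x \<in> B \<Longrightarrow>
      frechet_derivative (\<lambda>y. \<alpha> y v) (at x) u = frechet_derivative (\<lambda>y. \<alpha> y u) (at x) v"
  obtains y where "\<And>x. x \<in> B \<Longrightarrow> (y has_derivative \<alpha> x) (at x)"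
proof -
  define D where "D w z = frechet_derivative (\<lambda>y. \<alpha> y w) (at z)" for w z
  have D: "((\<lambda>y. \<alpha> y w) has_derivative D w z) (at z)" if "z \<in> B" for w z
    unfolding D_def using C1[of w] that by (intro Ck_on_Suc_derivative[of 0]) auto
  have Dcont: "continuous_on B (\<lambda>z. D w z u)" for w u
    using C1[of w] by (simp add: D_def)
  have acont: "continuous_on B (\<lambda>z. \<alpha> z w)" for w
    using Ck_on_Suc_imp[of 0] C1[of w] by simp
  \<comment> \<open>Needed because on the segments the argument \<open>w\<close> of the form moves
    together with the point.\<close>
  have Dexp: "D w z u = (\<Sum>b\<in>Basis. (w \<bullet> b) *\<^sub>R D b z u)" if "z \<in> B" for w z u
  proof -
    have "((\<lambda>y. \<Sum>b\<in>Basis. (w \<bullet> b) *\<^sub>R \<alpha> y b) has_derivative (\<lambda>u. \<Sum>b\<in>Basis. (w \<bullet> b) *\<^sub>R D b z u)) (at z)"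
      by (intro has_derivative_sum has_derivative_scaleR_right D that)
    then have "((\<lambda>y. \<alpha> y w) has_derivative (\<lambda>u. \<Sum>b\<in>Basis. (w \<bullet> b) *\<^sub>R D b z u)) (at z)"
      by (rule has_derivative_transform_within_open[OF _ assms(1) that])
        (simp add: linear_euclidean_expand[OF lin, of _ w])
    from has_derivative_unique[OF this D[OF that]] show ?thesis by metis
  qed
  define z where "z x t = x0 + t *\<^sub>R (x - x0)" for x t
  have zB: "z x t \<in> B" if "x \<in> B" "t \<in> {0..1}" for x t
    using convexD_alt[OF assms(2,3) that(1), of t] that(2) by (simp add: z_def algebra_simps)
  \<comment> \<open>\<open>F\<close> is \<open>\<alpha>\<close> on the velocity of the segment.
    \<open>G\<close> is its derivative in the endpoint \<open>x\<close>, with one term from the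
    moving point and one from the moving velocity.\<close>
  define F where "F x t = \<alpha> (z x t) (x - x0)" for x t
  define G where "G x t u = t *\<^sub>R D (x - x0) (z x t) u + \<alpha> (z x t) u" for x t u
  have dF: "((\<lambda>x. F x t) has_derivative G x t) (at x)" if "x \<in> B" "t \<in> {0..1}" for x t
  proof -
    have dz: "((\<lambda>x. z x t) has_derivative (\<lambda>u. t *\<^sub>R u)) (at x)"
      unfolding z_def by (auto intro!: derivative_eq_intros)
    have "((\<lambda>x. \<alpha> (z x t) b) has_derivative (\<lambda>u. D b (z x t) (t *\<^sub>R u))) (at x)" for b
      using has_derivative_compose[OF dz, of "\<lambda>y. \<alpha> y b"] D[OF zB[OF that]] by simp
    then have "((\<lambda>x. \<Sum>b\<in>Basis. ((x - x0) \<bullet> b) *\<^sub>R \<alpha> (z x t) b) has_derivative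
        (\<lambda>u. \<Sum>b\<in>Basis. ((x - x0) \<bullet> b) *\<^sub>R D b (z x t) (t *\<^sub>R u) + (u \<bullet> b) *\<^sub>R \<alpha> (z x t) b)) (at x)"
      by (auto intro!: derivative_eq_intros)
    moreover have "(\<Sum>b\<in>Basis. ((x - x0) \<bullet> b) *\<^sub>R D b (z x t) (t *\<^sub>R u) + (u \<bullet> b) *\<^sub>R \<alpha> (z x t) b) = G x t u" for u
      unfolding G_def Dexp[OF zB[OF that], of "x - x0"] linear_euclidean_expand[OF lin[OF zB[OF that]], of u]
        sum.distrib scaleR_sum_right
      using linear_cmul[OF has_derivative_linear[OF D[OF zB[OF that]]]] by (simp add: mult.commute)
    ultimately have "((\<lambda>x. \<Sum>b\<in>Basis. ((x - x0) \<bullet> b) *\<^sub>R \<alpha> (z x t) b) has_derivative G x t) (at x)"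
      by simp
    then show ?thesis
      by (rule has_derivative_transform_within_open[OF _ assms(1) that(1)])
        (use zB that in \<open>simp add: F_def linear_euclidean_expand[OF lin, of _ "_ - x0"]\<close>)
  qed
  have linG: "bounded_linear (G x t)" if "x \<in> B" "t \<in> {0..1}" for x t
    using dF[OF that] by (rule has_derivative_bounded_linear)
  define y where "y x = integral (cbox 0 1) (F x)" for x
  have zcont: "continuous_on (B \<times> cbox 0 1) (\<lambda>(x, t::real). z x t)"
    unfolding z_def split_beta by (intro continuous_intros)
  have zimg: "(\<lambda>(x, t). z x t) ` (B \<times> cbox 0 1) \<subseteq> B" using zB by auto
  have Gcont: "continuous_on (B \<times> cbox 0 1) (\<lambda>(x, t). G x t u)" for u
  proof -
    have "continuous_on (B \<times> cbox 0 1) (\<lambda>(x, t). t *\<^sub>R (\<Sum>b\<in>Basis. ((x - x0) \<bullet> b) *\<^sub>R D b (z x t) u) + \<alpha> (z x t) u)"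
      using continuous_on_compose2[OF Dcont zcont zimg] continuous_on_compose2[OF acont zcont zimg]
      unfolding split_beta by (intro continuous_intros) auto
    then show ?thesis
      by (rule continuous_on_eq) (use zB in \<open>auto simp: G_def Dexp[of _ "_ - x0"]\<close>)
  qed
  \<comment> \<open>Differentiation under the integral asks for a continuous family of bounded
    linear maps, so \<open>G\<close> is packaged as \<open>GB\<close>.\<close>
  define GB where "GB x t = Blinfun (G x t)" for x t
  have GB: "blinfun_apply (GB x t) = G x t" if "x \<in> B" "t \<in> {0..1}" for x t
    unfolding GB_def using linG[OF that] by (rule bounded_linear_Blinfun_apply)
  have Fcont: "continuous_on {0..1} (F x)" if "x \<in> B" for x
    unfolding F_def z_def using zB[OF that]
    by (intro continuous_on_compose2[OF acont, of _ "\<lambda>t. x0 + t *\<^sub>R (x - x0)"] continuous_intros)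
      (auto simp: z_def)
  have GBcont: "continuous_on (B \<times> cbox 0 1) (\<lambda>(x, t). GB x t)"
    unfolding split_beta
    by (rule continuous_on_blinfun_componentwise, rule continuous_on_eq[OF Gcont])
      (auto simp: GB)
  have "(y has_derivative \<alpha> x) (at x)" if x: "x \<in> B" for x
  proof -
    have "((\<lambda>x. integral (cbox 0 1) (F x)) has_derivative integral (cbox 0 1) (GB x)) (at x within B)"
      by (rule leibniz_rule[OF _ _ GBcont x assms(2)])
        (use dF GB Fcont in \<open>auto intro: has_derivative_at_withinI integrable_continuous_real\<close>)
    moreover have "blinfun_apply (integral (cbox 0 1) (GB x)) = \<alpha> x"
    proof (rule ext)
      fix u
      have "continuous_on (cbox 0 1) (\<lambda>t. GB x t)"
        using continuous_on_compose2[OF GBcont continuous_on_Pair[OF continuous_on_const continuous_on_id], of x "cbox 0 1"] x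
        by (simp add: image_subset_iff)
      then have "GB x integrable_on cbox 0 1" by (rule integrable_continuous)
      then have "blinfun_apply (integral (cbox 0 1) (GB x)) u = integral (cbox 0 1) (\<lambda>t. GB x t u)"
        by (rule blinfun_apply_integral)
      also have "\<dots> = integral {0..1} (\<lambda>t. G x t u)"
        using x by (auto intro!: integral_cong simp: GB)
      \<comment> \<open>By closedness \<open>G x t u\<close> is the derivative of
        \<open>t *\<^sub>R \<alpha> (z x t) u\<close> in \<open>t\<close>; the factor
        \<open>t\<close> kills the contribution of the base point.\<close>
      also have "\<dots> = 1 *\<^sub>R \<alpha> (z x 1) u - 0 *\<^sub>R \<alpha> (z x 0) u"
      proof (rule integral_unique, rule fundamental_theorem_of_calculus)
        fix t :: real assume t: "t \<in> {0..1}"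
        have dz: "(z x has_derivative (\<lambda>r. r *\<^sub>R (x - x0))) (at t)"
          unfolding z_def by (auto intro!: derivative_eq_intros)
        have lD: "linear (D u (z x t))" using D[OF zB[OF x t]] by (rule has_derivative_linear)
        have "((\<lambda>t. \<alpha> (z x t) u) has_derivative (\<lambda>r. r *\<^sub>R D u (z x t) (x - x0))) (at t)"
          using has_derivative_compose[OF dz D[OF zB[OF x t]], of u]
          by (simp add: linear_cmul[OF lD])
        then have "((\<lambda>t. \<alpha> (z x t) u) has_vector_derivative D u (z x t) (x - x0)) (at t)"
          by (simp add: has_vector_derivative_def)
        then have "((\<lambda>t. t *\<^sub>R \<alpha> (z x t) u) has_vector_derivative
            t *\<^sub>R D u (z x t) (x - x0) + 1 *\<^sub>R \<alpha> (z x t) u) (at t)"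
          by (intro has_vector_derivative_scaleR DERIV_ident)
        moreover have "D u (z x t) (x - x0) = D (x - x0) (z x t) u"
          unfolding D_def by (rule closed[OF zB[OF x t]])
        ultimately show "((\<lambda>t. t *\<^sub>R \<alpha> (z x t) u) has_vector_derivative G x t u) (at t within {0..1})"
          by (simp add: G_def has_vector_derivative_at_within)
      qed simp
      finally show "blinfun_apply (integral (cbox 0 1) (GB x)) u = \<alpha> x u" by (simp add: z_def)
    qed
    ultimately show ?thesis
      unfolding y_def[abs_def] using at_within_open[OF x assms(1)] by (simp only:)
  qed
  then show ?thesis by (rule that)
qed

section \<open>Differentiation in a chart\<close>

text \<open>Both sides choose from the same set of derivatives, so they agree even where this set is
  empty.\<close>

lemma frechet_derivative_cong_open:
  assumes "open S" "x \<in> S" "\<And>y. y \<in> S \<Longrightarrow> f y = g y"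
  shows "frechet_derivative f (at x) = frechet_derivative g (at x)"
proof -
  have "(f has_derivative D) (at x) \<longleftrightarrow> (g has_derivative D) (at x)" for D
    using has_derivative_transform_within_open[OF _ assms(1,2)] assms(3) by metis
  then show ?thesis by (simp add: frechet_derivative_def)
qed

locale coordinate_chart =
  fixes c :: "('m, 'n::finite) chart"
  assumes open_image: "open (cmap c ` cdom c)"
    and inj_cmap: "inj_on (cmap c) (cdom c)"
begin

lemma cinv_cmap: "p \<in> cdom c \<Longrightarrow> cinv c (cmap c p) = p"
  using inj_cmap by (rule inv_into_f_f)

lemma smooth_in_Ck: "smooth_in c f \<Longrightarrow> Ck_on k (cmap c ` cdom c) (f \<circ> cinv c)"
  by (simp add: smooth_in_def smooth_on_def)

lemma smooth_inI: "(\<And>k. Ck_on k (cmap c ` cdom c) (f \<circ> cinv c)) \<Longrightarrow> smooth_in c f"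
  by (simp add: smooth_in_def smooth_on_def)

lemma smooth_in_cong:
  assumes "smooth_in c f" "\<And>q. q \<in> cdom c \<Longrightarrow> f q = f' q"
  shows "smooth_in c f'"
  by (rule smooth_inI, rule Ck_on_cong[OF open_image _ smooth_in_Ck[OF assms(1)]])
    (auto simp: assms(2) cinv_cmap)

lemma dif_cong:
  assumes "p \<in> cdom c" "\<And>q. q \<in> cdom c \<Longrightarrow> f q = f' q"
  shows "dif c f p v = dif c f' p v"
proof -
  have "frechet_derivative (f \<circ> cinv c) (at (cmap c p)) = frechet_derivative (f' \<circ> cinv c) (at (cmap c p))"
    by (rule frechet_derivative_cong_open[OF open_image]) (use assms in \<open>auto simp: cinv_cmap\<close>)
  then show ?thesis by (simp add: dif_def)
qed

lemma has_derivative_dif: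
  assumes "smooth_in c f" "p \<in> cdom c"
  shows "((f \<circ> cinv c) has_derivative dif c f p) (at (cmap c p))"
proof -
  have "dif c f p = frechet_derivative (f \<circ> cinv c) (at (cmap c p))"
    by (simp add: dif_def fun_eq_iff)
  then show ?thesis
    using Ck_on_Suc_derivative[OF smooth_in_Ck[OF assms(1), of "Suc 0"]] assms(2) by simp
qed

lemma dif_eqI:
  "((f \<circ> cinv c) has_derivative D) (at (cmap c p)) \<Longrightarrow> dif c f p v = D v"
  unfolding dif_def using frechet_derivative_at by metis

lemma linear_dif: "smooth_in c f \<Longrightarrow> p \<in> cdom c \<Longrightarrow> linear (dif c f p)"
  using has_derivative_dif by (rule has_derivative_linear)

lemma smooth_in_const: "smooth_in c (\<lambda>q. a)"
  by (rule smooth_inI) (simp add: Ck_on_const[OF open_image] o_def)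

lemma dif_const: "dif c (\<lambda>q. a) p v = 0"
  by (rule dif_eqI) (simp add: o_def)

lemma smooth_in_add: "smooth_in c f \<Longrightarrow> smooth_in c h \<Longrightarrow> smooth_in c (\<lambda>q. f q + h q)"
  using Ck_on_add[OF open_image smooth_in_Ck smooth_in_Ck] by (intro smooth_inI) (simp add: o_def)

lemma dif_add:
  "smooth_in c f \<Longrightarrow> smooth_in c h \<Longrightarrow> p \<in> cdom c \<Longrightarrow>
    dif c (\<lambda>q. f q + h q) p v = dif c f p v + dif c h p v"
  using has_derivative_add[OF has_derivative_dif has_derivative_dif]
  by (intro dif_eqI) (simp add: o_def)

lemma smooth_in_linear: "bounded_linear L \<Longrightarrow> smooth_in c f \<Longrightarrow> smooth_in c (\<lambda>q. L (f q))"
  using Ck_on_bounded_linear[OF open_image _ smooth_in_Ck] by (intro smooth_inI) (simp add: o_def)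

lemma dif_linear:
  "bounded_linear L \<Longrightarrow> smooth_in c f \<Longrightarrow> p \<in> cdom c \<Longrightarrow>
    dif c (\<lambda>q. L (f q)) p v = L (dif c f p v)"
  using bounded_linear.has_derivative[OF _ has_derivative_dif]
  by (intro dif_eqI) (simp add: o_def)

lemma dif_minus:
  "smooth_in c f \<Longrightarrow> p \<in> cdom c \<Longrightarrow> dif c (\<lambda>q. - f q) p v = - dif c f p v"
  by (rule dif_linear[OF bounded_linear_minus[OF bounded_linear_ident]])

lemma smooth_in_bilinear:
  "bounded_bilinear B \<Longrightarrow> smooth_in c f \<Longrightarrow> smooth_in c h \<Longrightarrow> smooth_in c (\<lambda>q. B (f q) (h q))"
  using Ck_on_bilinear[OF open_image _ smooth_in_Ck smooth_in_Ck]
  by (intro smooth_inI) (simp add: o_def)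

lemma dif_bilinear:
  "bounded_bilinear B \<Longrightarrow> smooth_in c f \<Longrightarrow> smooth_in c h \<Longrightarrow> p \<in> cdom c \<Longrightarrow>
    dif c (\<lambda>q. B (f q) (h q)) p v = B (f p) (dif c h p v) + B (dif c f p v) (h p)"
  using bounded_bilinear.FDERIV[OF _ has_derivative_dif has_derivative_dif]
  by (intro dif_eqI) (simp add: o_def cinv_cmap)

lemma smooth_in_sum:
  "(\<And>i. i \<in> I \<Longrightarrow> smooth_in c (f i)) \<Longrightarrow> smooth_in c (\<lambda>q. \<Sum>i\<in>I. f i q)"
  by (induction I rule: infinite_finite_induct) (auto intro: smooth_in_const smooth_in_add)

lemma dif_sum:
  "(\<And>i. i \<in> I \<Longrightarrow> smooth_in c (f i)) \<Longrightarrow> p \<in> cdom c \<Longrightarrow>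
    dif c (\<lambda>q. \<Sum>i\<in>I. f i q) p v = (\<Sum>i\<in>I. dif c (f i) p v)"
  by (induction I rule: infinite_finite_induct) (auto simp: dif_const dif_add smooth_in_sum)

section \<open>Fields of linear maps applied to vector fields\<close>

lemma smooth_in_apply:
  fixes X :: "'m \<Rightarrow> 'a::euclidean_space"
  assumes "\<And>q. q \<in> cdom c \<Longrightarrow> linear (L q)" "\<And>v. smooth_in c (\<lambda>q. L q v)" "smooth_in c X"
  shows "smooth_in c (\<lambda>q. L q (X q))"
proof (rule smooth_in_cong)
  show "smooth_in c (\<lambda>q. \<Sum>b\<in>Basis. (X q \<bullet> b) *\<^sub>R L q b)"
    by (intro smooth_in_sum smooth_in_bilinear[OF bounded_bilinear_scaleR]
        smooth_in_linear[OF bounded_linear_inner_left] assms)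
qed (simp flip: linear_euclidean_expand[OF assms(1)])

text \<open>Basis expansion reduces this to the product rule for scalar multiples. Freezing the
  argument at \<open>X p\<close> leaves derivatives of \<open>L\<close> on constant vectors, which
  is where \<open>L\<close> is known to be smooth.\<close>

lemma dif_apply:
  fixes X :: "'m \<Rightarrow> 'a::euclidean_space"
  assumes "\<And>q. q \<in> cdom c \<Longrightarrow> linear (L q)" "\<And>v. smooth_in c (\<lambda>q. L q v)" "smooth_in c X"
    and p: "p \<in> cdom c"
  shows "dif c (\<lambda>q. L q (X q)) p u = dif c (\<lambda>q. L q (X p)) p u + L p (dif c X p u)"
proof -
  note sm = smooth_in_linear[OF bounded_linear_inner_left assms(3)]
  have "dif c (\<lambda>q. L q (X q)) p u = dif c (\<lambda>q. \<Sum>b\<in>Basis. (X q \<bullet> b) *\<^sub>R L q b) p u"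
    by (rule dif_cong[OF p]) (simp flip: linear_euclidean_expand[OF assms(1)])
  also have "\<dots> = (\<Sum>b\<in>Basis. (X p \<bullet> b) *\<^sub>R dif c (\<lambda>q. L q b) p u) + (\<Sum>b\<in>Basis. (dif c X p u \<bullet> b) *\<^sub>R L p b)"
    by (simp add: dif_sum smooth_in_bilinear[OF bounded_bilinear_scaleR sm assms(2)] p
        dif_bilinear[OF bounded_bilinear_scaleR sm assms(2) p] sum.distrib
        dif_linear[OF bounded_linear_inner_left assms(3) p])
  also have "(\<Sum>b\<in>Basis. (X p \<bullet> b) *\<^sub>R dif c (\<lambda>q. L q b) p u) = dif c (\<lambda>q. \<Sum>b\<in>Basis. (X p \<bullet> b) *\<^sub>R L q b) p u"
    by (simp add: dif_sum smooth_in_linear[OF bounded_linear_scaleR_right assms(2)] p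
        dif_linear[OF bounded_linear_scaleR_right assms(2) p])
  also have "\<dots> = dif c (\<lambda>q. L q (X p)) p u"
    by (rule dif_cong[OF p]) (simp flip: linear_euclidean_expand[OF assms(1)])
  finally show ?thesis by (simp flip: linear_euclidean_expand[OF assms(1)[OF p]])
qed

lemma smooth_in_bilinear_apply:
  fixes X :: "'m \<Rightarrow> 'a::euclidean_space" and Y :: "'m \<Rightarrow> 'b::euclidean_space"
  assumes "\<And>q. q \<in> cdom c \<Longrightarrow> bilinear (B q)" "\<And>u v. smooth_in c (\<lambda>q. B q u v)"
    and "smooth_in c X" "smooth_in c Y"
  shows "smooth_in c (\<lambda>q. B q (X q) (Y q))"
  by (rule smooth_in_apply[where L = "\<lambda>q. B q (X q)"], use assms in \<open>simp add: bilinear_def\<close>,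
      rule smooth_in_apply[where L = "\<lambda>q u. B q u _"])
    (use assms in \<open>auto simp: bilinear_def\<close>)

lemma smooth_in_dif_const:
  assumes "smooth_in c f"
  shows "smooth_in c (\<lambda>q. dif c f q v)"
proof (rule smooth_inI)
  fix k
  have "Ck_on k (cmap c ` cdom c) (\<lambda>x. frechet_derivative (f \<circ> cinv c) (at x) v)"
    using smooth_in_Ck[OF assms, of "Suc k"] by simp
  then show "Ck_on k (cmap c ` cdom c) ((\<lambda>q. dif c f q v) \<circ> cinv c)"
    by (rule Ck_on_cong[OF open_image, rotated]) (auto simp: dif_def cinv_cmap)
qed

lemma smooth_in_dif: "smooth_in c f \<Longrightarrow> smooth_in c X \<Longrightarrow> smooth_in c (\<lambda>q. dif c f q (X q))"
  by (rule smooth_in_apply) (auto intro: linear_dif smooth_in_dif_const)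

lemma dif_dif:
  "smooth_in c f \<Longrightarrow> smooth_in c X \<Longrightarrow> p \<in> cdom c \<Longrightarrow>
    dif c (\<lambda>q. dif c f q (X q)) p u = dif c (\<lambda>q. dif c f q (X p)) p u + dif c f p (dif c X p u)"
  by (rule dif_apply) (auto intro: linear_dif smooth_in_dif_const)

section \<open>Symmetry of second derivatives and the bracket\<close>

lemma dif_dif_commute:
  fixes f :: "'m \<Rightarrow> 'b::euclidean_space"
  assumes "smooth_in c f" "p \<in> cdom c"
  shows "dif c (\<lambda>q. dif c f q u) p v = dif c (\<lambda>q. dif c f q v) p u"
proof -
  have *: "dif c (\<lambda>q. dif c f q u) p v =
    frechet_derivative (\<lambda>x. frechet_derivative (f \<circ> cinv c) (at x) u) (at (cmap c p)) v" for u v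
  proof -
    have "frechet_derivative ((\<lambda>q. dif c f q u) \<circ> cinv c) (at (cmap c p)) =
      frechet_derivative (\<lambda>x. frechet_derivative (f \<circ> cinv c) (at x) u) (at (cmap c p))"
      by (rule frechet_derivative_cong_open[OF open_image])
        (use assms in \<open>auto simp: dif_def cinv_cmap\<close>)
    then show ?thesis by (simp add: dif_def[of c "\<lambda>q. dif c f q u"])
  qed
  show ?thesis
    unfolding * by (rule second_derivative_commute[OF open_image _ smooth_in_Ck[OF assms(1)]])
      (use assms in auto)
qed

text \<open>The second-order terms of the two iterated derivatives agree by symmetry; what survives
  are the first-order terms, in which one field is differentiated along the other.\<close>

lemma dif_bracket:
  fixes f :: "'m \<Rightarrow> 'b::euclidean_space"
  assumes "smooth_in c f" "smooth_in c X" "smooth_in c Y" "p \<in> cdom c"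
  shows "dif c (\<lambda>q. dif c f q (Y q)) p (X p) - dif c (\<lambda>q. dif c f q (X q)) p (Y p) =
    dif c f p (bracket c X Y p)"
  using assms
  by (simp add: dif_dif dif_dif_commute[of f p "X p" "Y p"] bracket_def linear_diff[OF linear_dif])

end

section \<open>Geometry of parabolic spheres in a chart\<close>

locale gauss_chart = coordinate_chart c
  for c :: "('m, 'n::finite) chart" +
  fixes \<phi> \<xi> :: "'m \<Rightarrow> real ^ 'n option" and \<Gamma> :: "('m, 'n) conn" and g :: "('m, 'n) form2"
  assumes smooth_\<phi>: "smooth_in c \<phi>"
    and inj_\<phi>: "p \<in> cdom c \<Longrightarrow> inj (dif c \<phi> p)"
    and smooth_\<xi>: "smooth_in c \<xi>"
    and transversal: "p \<in> cdom c \<Longrightarrow> \<xi> p \<notin> range (dif c \<phi> p)"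
    and bilinear_\<Gamma>: "p \<in> cdom c \<Longrightarrow> bilinear (\<Gamma> c p)"
    and smooth_\<Gamma>: "smooth_in c (\<lambda>p. \<Gamma> c p u v)"
    and bilinear_g: "p \<in> cdom c \<Longrightarrow> bilinear (g c p)"
    and smooth_g: "smooth_in c (\<lambda>p. g c p u v)"
    and sym_g: "p \<in> cdom c \<Longrightarrow> g c p u v = g c p v u"
    and nondegenerate_g: "p \<in> cdom c \<Longrightarrow> (\<And>v. g c p u v = 0) \<Longrightarrow> u = 0"
    and gauss: "smooth_in c X \<Longrightarrow> smooth_in c Y \<Longrightarrow> p \<in> cdom c \<Longrightarrow>
      dif c (\<lambda>q. dif c \<phi> q (Y q)) p (X p) =
        dif c \<phi> p (cov \<Gamma> c X Y p) + g c p (X p) (Y p) *\<^sub>R \<xi> p"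
begin

section \<open>Tangential and transversal parts\<close>

lemma linear_\<phi>: "p \<in> cdom c \<Longrightarrow> linear (dif c \<phi> p)"
  using smooth_\<phi> by (rule linear_dif)

text \<open>This is how identities between ambient vectors are split into a tangential and a
  transversal equation.\<close>

lemma tangent_transversal_independent:
  assumes "p \<in> cdom c" "dif c \<phi> p v + t *\<^sub>R \<xi> p = 0"
  shows "v = 0" "t = 0"
proof -
  note lin = linear_\<phi>[OF assms(1)]
  show t: "t = 0"
  proof (rule ccontr)
    assume "t \<noteq> 0"
    have "\<xi> p = (inverse t * t) *\<^sub>R \<xi> p" using \<open>t \<noteq> 0\<close> by simp
    also have "\<dots> = dif c \<phi> p (- inverse t *\<^sub>R v)"
      using assms(2) by (simp add: linear_cmul[OF lin] linear_neg[OF lin] add_eq_0_iff flip: scaleR_scaleR) 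
    finally show False using transversal[OF assms(1)] by (metis rangeI)
  qed
  then show "v = 0"
    using assms(2) injD[OF inj_\<phi>[OF assms(1)], of v 0] linear_0[OF lin] by simp
qed

text \<open>The rows are the images of the coordinate frame and the transversal vector; a vanishing
  combination of them splits by the preceding lemma, so they are independent.\<close>

lemma det_transversal_frame_nonzero:
  assumes "p \<in> cdom c"
  shows "det (\<chi> k. case k of None \<Rightarrow> \<xi> p | Some i \<Rightarrow> dif c \<phi> p (axis i 1)) \<noteq> 0"
    (is "det ?M \<noteq> 0")
proof -
  have "\<forall>k. a k = 0" if "(\<Sum>k\<in>UNIV. a k *s row k ?M) = 0" for a
  proof -
    have "(\<Sum>k\<in>UNIV. a k *s row k ?M) =
        dif c \<phi> p (\<Sum>i\<in>UNIV. a (Some i) *\<^sub>R axis i 1) + a None *\<^sub>R \<xi> p"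
      by (simp add: UNIV_option_conv sum.reindex row_def scalar_mult_eq_scaleR vec_nth_inverse
          linear_sum[OF linear_\<phi>[OF assms]] linear_cmul[OF linear_\<phi>[OF assms]])
    with that tangent_transversal_independent[OF assms]
    have "(\<Sum>i\<in>UNIV. a (Some i) *\<^sub>R axis i 1) = (0 :: real ^ 'n)" "a None = 0" by metis+
    moreover have "(\<Sum>i\<in>UNIV. a (Some i) *\<^sub>R axis i 1) = (\<chi> i. a (Some i))"
      using basis_expansion[of "\<chi> i. a (Some i)"] by (simp add: scalar_mult_eq_scaleR)
    ultimately show ?thesis
      by (metis option.exhaust vec_lambda_beta zero_index)
  qed
  then have "\<exists>B. ?M ** B = mat 1" unfolding matrix_right_invertible_independent_rows by blast
  then show ?thesis using invertible_det_nz invertible_right_inverse by blast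
qed

lemma gauss_const:
  "p \<in> cdom c \<Longrightarrow> dif c (\<lambda>q. dif c \<phi> q v) p u = dif c \<phi> p (\<Gamma> c p u v) + g c p u v *\<^sub>R \<xi> p"
  using gauss[OF smooth_in_const[of u] smooth_in_const[of v]] by (simp add: cov_def dif_const)

text \<open>Here \<open>t\<close> stands for the value of \<open>\<tau>\<close> on \<open>u\<close>.
  Differentiating the determinant row by row, the tangential rows reproduce the terms of the
  parallelism condition, and the row of \<open>\<xi>\<close> contributes \<open>t\<close> times the
  volume of the frame, which is nonzero.\<close>

lemma transversal_form_eq_0:
  assumes p: "p \<in> cdom c"
    and weingarten: "dif c \<xi> p u = t *\<^sub>R \<xi> p"
    and parallel: "dif c (\<lambda>q. induced_vol \<phi> \<xi> c q (\<lambda>i. axis i 1)) p u =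
      (\<Sum>i\<in>UNIV. induced_vol \<phi> \<xi> c p ((\<lambda>j. axis j 1)(i := \<Gamma> c p u (axis i 1))))"
  shows "t = 0"
proof -
  define M where "M q = (\<chi> k. case k of None \<Rightarrow> \<xi> q | Some i \<Rightarrow> dif c \<phi> q (axis i 1))" for q
  define M' where "M' k = (case k of None \<Rightarrow> dif c \<xi> p | Some i \<Rightarrow> dif c (\<lambda>q. dif c \<phi> q (axis i 1)) p)" for k
  have "((\<lambda>x. M (cinv c x) $ k) has_derivative M' k) (at (cmap c p))" for k
    using has_derivative_dif[OF smooth_\<xi> p] has_derivative_dif[OF smooth_in_dif_const[OF smooth_\<phi>] p]
    by (cases k) (auto simp: M_def M'_def o_def)
  from dif_eqI[of "\<lambda>q. det (M q)", unfolded o_def, OF has_derivative_det[OF this]]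
  have D: "dif c (\<lambda>q. det (M q)) p u = (\<Sum>k\<in>UNIV. det (\<chi> i. if i = k then M' k u else M p $ i))"
    unfolding cinv_cmap[OF p] .
  have split: "(\<Sum>k\<in>UNIV. det (\<chi> i. if i = k then M' k u else M p $ i)) =
      det (\<chi> i. if i = None then M' None u else M p $ i) +
      (\<Sum>i\<in>UNIV. det (\<chi> j. if j = Some i then M' (Some i) u else M p $ j))"
    by (simp add: UNIV_option_conv sum.reindex)
  have row_None: "det (\<chi> i. if i = None then M' None u else M p $ i) = t * det (M p)"
  proof -
    have "(\<chi> i. if i = None then M' None u else M p $ i) =
        (\<chi> i. if i = None then t *s (M p $ i) else M p $ i)"
      by (auto simp: vec_eq_iff M'_def M_def weingarten)
    then show ?thesis by (simp add: det_row_mul)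
  qed
  have row_Some: "det (\<chi> j. if j = Some i then M' (Some i) u else M p $ j) =
      induced_vol \<phi> \<xi> c p ((\<lambda>j. axis j 1)(i := \<Gamma> c p u (axis i 1)))" for i
  proof -
    have "(\<chi> j. if j = Some i then M' (Some i) u else M p $ j) =
        (\<chi> j. if j = Some i then dif c \<phi> p (\<Gamma> c p u (axis i 1)) + g c p u (axis i 1) *s \<xi> p else M p $ j)"
      by (auto simp: vec_eq_iff M'_def gauss_const[OF p])
    then have "det (\<chi> j. if j = Some i then M' (Some i) u else M p $ j) =
        det (\<chi> j. if j = Some i then dif c \<phi> p (\<Gamma> c p u (axis i 1)) else M p $ j) +
        g c p u (axis i 1) * det (\<chi> j. if j = Some i then \<xi> p else M p $ j)"
      by (simp add: det_row_add det_row_mul)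
    \<comment> \<open>The transversal part of a differentiated tangential row repeats the row of
      \<open>\<xi>\<close> and drops out.\<close>
    also have "det (\<chi> j. if j = Some i then \<xi> p else M p $ j) = 0"
      by (rule det_identical_rows[of None "Some i"]) (auto simp: row_def M_def vec_eq_iff)
    also have "(\<chi> j. if j = Some i then dif c \<phi> p (\<Gamma> c p u (axis i 1)) else M p $ j) =
        (\<chi> k. case k of None \<Rightarrow> \<xi> p | Some j \<Rightarrow> dif c \<phi> p (((\<lambda>j. axis j 1)(i := \<Gamma> c p u (axis i 1))) j))"
      by (auto simp: vec_eq_iff M_def split: option.split)
    finally show ?thesis by (simp add: induced_vol_def)
  qed
  have "dif c (\<lambda>q. det (M q)) p u = dif c (\<lambda>q. induced_vol \<phi> \<xi> c q (\<lambda>i. axis i 1)) p u"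
    by (simp add: M_def induced_vol_def)
  then have "t * det (M p) = 0" using parallel D by (simp add: split row_None row_Some)
  then show ?thesis using det_transversal_frame_nonzero[OF p] by (simp add: M_def)
qed

lemma \<Gamma>_sym:
  assumes "p \<in> cdom c" shows "\<Gamma> c p u v = \<Gamma> c p v u"
proof -
  have "dif c \<phi> p (\<Gamma> c p u v) = dif c \<phi> p (\<Gamma> c p v u)"
    using gauss_const[OF assms, of v u] gauss_const[OF assms, of u v]
      dif_dif_commute[OF smooth_\<phi> assms, of u v] sym_g[OF assms, of u v] by simp
  then show ?thesis using inj_\<phi>[OF assms] by (auto dest: injD)
qed

lemma cov_torsion: "p \<in> cdom c \<Longrightarrow> cov \<Gamma> c X Y p - cov \<Gamma> c Y X p = bracket c X Y p"
  using \<Gamma>_sym by (simp add: cov_def bracket_def)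

lemma smooth_in_cov:
  assumes "smooth_in c X" "smooth_in c Y"
  shows "smooth_in c (cov \<Gamma> c X Y)"
  using smooth_in_add[OF smooth_in_dif[OF assms(2,1)]
      smooth_in_bilinear_apply[OF bilinear_\<Gamma> smooth_\<Gamma> assms]]
  by (simp add: cov_def[abs_def])

lemma smooth_in_g: "smooth_in c X \<Longrightarrow> smooth_in c Y \<Longrightarrow> smooth_in c (\<lambda>q. g c q (X q) (Y q))"
  by (rule smooth_in_bilinear_apply[OF bilinear_g smooth_g])

end

section \<open>Curvature and Codazzi equation for a constant transversal field\<close>

locale parabolic_chart = gauss_chart +
  assumes dif_\<xi>: "p \<in> cdom c \<Longrightarrow> dif c \<xi> p v = 0"
begin

lemma gauss_twice:
  assumes "smooth_in c X" "smooth_in c Y" "smooth_in c Z" and p: "p \<in> cdom c"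
  shows "dif c (\<lambda>q. dif c (\<lambda>r. dif c \<phi> r (Z r)) q (Y q)) p (X p) =
    dif c \<phi> p (cov \<Gamma> c X (cov \<Gamma> c Y Z) p) +
    (g c p (X p) (cov \<Gamma> c Y Z p) + dif c (\<lambda>q. g c q (Y q) (Z q)) p (X p)) *\<^sub>R \<xi> p"
proof -
  note smYZ = smooth_in_cov[OF assms(2,3)]
  have "dif c (\<lambda>q. dif c (\<lambda>r. dif c \<phi> r (Z r)) q (Y q)) p (X p) =
      dif c (\<lambda>q. dif c \<phi> q (cov \<Gamma> c Y Z q) + g c q (Y q) (Z q) *\<^sub>R \<xi> q) p (X p)"
    by (rule dif_cong[OF p]) (rule gauss[OF assms(2,3)])
  also have "\<dots> = dif c (\<lambda>q. dif c \<phi> q (cov \<Gamma> c Y Z q)) p (X p) +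
      dif c (\<lambda>q. g c q (Y q) (Z q) *\<^sub>R \<xi> q) p (X p)"
    by (rule dif_add[OF smooth_in_dif[OF smooth_\<phi> smYZ]
          smooth_in_bilinear[OF bounded_bilinear_scaleR smooth_in_g[OF assms(2,3)] smooth_\<xi>] p])
  also have "dif c (\<lambda>q. g c q (Y q) (Z q) *\<^sub>R \<xi> q) p (X p) = dif c (\<lambda>q. g c q (Y q) (Z q)) p (X p) *\<^sub>R \<xi> p"
    by (simp add: dif_bilinear[OF bounded_bilinear_scaleR smooth_in_g[OF assms(2,3)] smooth_\<xi> p] dif_\<xi>[OF p])
  finally show ?thesis by (simp add: gauss[OF assms(1) smYZ p] algebra_simps)
qed

text \<open>Derivatives along \<open>X\<close> and \<open>Y\<close> of the ambient field obtained
  from \<open>Z\<close> commute up to the bracket. Expanding by the Gauss formula, the tangential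
  part gives the first claim and the transversal part the second.\<close>

lemma
  assumes "smooth_in c X" "smooth_in c Y" "smooth_in c Z" and p: "p \<in> cdom c"
  shows curvature_eq_0: "cov \<Gamma> c X (cov \<Gamma> c Y Z) p - cov \<Gamma> c Y (cov \<Gamma> c X Z) p
      - cov \<Gamma> c (bracket c X Y) Z p = 0"
    and codazzi: "dif c (\<lambda>q. g c q (Y q) (Z q)) p (X p)
        - g c p (cov \<Gamma> c X Y p) (Z p) - g c p (Y p) (cov \<Gamma> c X Z p) =
      dif c (\<lambda>q. g c q (X q) (Z q)) p (Y p)
        - g c p (cov \<Gamma> c Y X p) (Z p) - g c p (X p) (cov \<Gamma> c Y Z p)"
proof -
  let ?F = "\<lambda>r. dif c \<phi> r (Z r)" and ?w = "bracket c X Y p"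
  \<comment> \<open>The bracket is replaced by the constant field with its value at
    \<open>p\<close>: the covariant derivative depends on the direction field only through this
    value, and the Gauss formula then applies to a field known to be smooth.\<close>
  have "cov \<Gamma> c (\<lambda>q. ?w) Z p = cov \<Gamma> c (bracket c X Y) Z p"
    by (simp add: cov_def)
  then have "dif c ?F p ?w = dif c \<phi> p (cov \<Gamma> c (bracket c X Y) Z p) + g c p ?w (Z p) *\<^sub>R \<xi> p"
    using gauss[OF smooth_in_const assms(3) p, of ?w] by simp
  with dif_bracket[OF smooth_in_dif[OF smooth_\<phi> assms(3)] assms(1,2) p]
    gauss_twice[OF assms(1-3) p] gauss_twice[OF assms(2,1,3) p]
  have *: "dif c \<phi> p (cov \<Gamma> c X (cov \<Gamma> c Y Z) p - cov \<Gamma> c Y (cov \<Gamma> c X Z) p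
        - cov \<Gamma> c (bracket c X Y) Z p) +
      (g c p (X p) (cov \<Gamma> c Y Z p) + dif c (\<lambda>q. g c q (Y q) (Z q)) p (X p)
       - (g c p (Y p) (cov \<Gamma> c X Z p) + dif c (\<lambda>q. g c q (X q) (Z q)) p (Y p))
       - g c p ?w (Z p)) *\<^sub>R \<xi> p = 0"
    by (simp add: linear_diff[OF linear_\<phi>[OF p]] linear_add[OF linear_\<phi>[OF p]]
        scaleR_left_diff_distrib algebra_simps)
  show "cov \<Gamma> c X (cov \<Gamma> c Y Z) p - cov \<Gamma> c Y (cov \<Gamma> c X Z) p
      - cov \<Gamma> c (bracket c X Y) Z p = 0"
    using tangent_transversal_independent(1)[OF p *] .
  have "g c p ?w (Z p) = g c p (cov \<Gamma> c X Y p) (Z p) - g c p (cov \<Gamma> c Y X p) (Z p)"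
    using bilinear_lsub[OF bilinear_g[OF p]] cov_torsion[OF p] by metis
  then show "dif c (\<lambda>q. g c q (Y q) (Z q)) p (X p)
        - g c p (cov \<Gamma> c X Y p) (Z p) - g c p (Y p) (cov \<Gamma> c X Z p) =
      dif c (\<lambda>q. g c q (X q) (Z q)) p (Y p)
        - g c p (cov \<Gamma> c Y X p) (Z p) - g c p (X p) (cov \<Gamma> c Y Z p)"
    using tangent_transversal_independent(2)[OF p *] by linarith
qed

end

section \<open>Hermitian structure and its 2-form\<close>

locale hermitian_chart = gauss_chart c \<phi> \<xi> \<Gamma> g
  for c :: "('m, 'n::finite) chart" and \<phi> \<xi> \<Gamma> g +
  fixes J :: "('m, 'n) endo"
  assumes linear_J: "p \<in> cdom c \<Longrightarrow> linear (J c p)"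
    and smooth_J: "smooth_in c (\<lambda>p. J c p v)"
    and J_J: "p \<in> cdom c \<Longrightarrow> J c p (J c p v) = - v"
    and hermitian_J: "p \<in> cdom c \<Longrightarrow> g c p (J c p u) (J c p v) = g c p u v"
begin

lemma J_skew: "p \<in> cdom c \<Longrightarrow> g c p u (J c p v) = - g c p (J c p u) v"
  using hermitian_J[of p u "J c p v"] J_J[of p v] bilinear_rneg[OF bilinear_g[of p]] by simp

lemma smooth_in_J: "smooth_in c X \<Longrightarrow> smooth_in c (\<lambda>q. J c q (X q))"
  by (rule smooth_in_apply) (auto intro: linear_J smooth_J)

text \<open>The Kaehler form g(\<cdot>, J\<cdot>) and the form g(J\<cdot>, \<cdot>) of a special
  parabolic sphere are negatives of each other by \<open>J_skew\<close>; this transfers covariant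
  derivatives between the two conventions.\<close>

lemma cov_kaehler_form:
  assumes "smooth_in c Y" "smooth_in c Z" and p: "p \<in> cdom c"
  shows "dif c (\<lambda>q. g c q (Y q) (J c q (Z q))) p (X p)
    - g c p (cov \<Gamma> c X Y p) (J c p (Z p)) - g c p (Y p) (J c p (cov \<Gamma> c X Z p)) =
    - (dif c (\<lambda>q. g c q (J c q (Y q)) (Z q)) p (X p)
        - g c p (J c p (cov \<Gamma> c X Y p)) (Z p) - g c p (J c p (Y p)) (cov \<Gamma> c X Z p))"
proof -
  have "dif c (\<lambda>q. g c q (Y q) (J c q (Z q))) p (X p) = dif c (\<lambda>q. - g c q (J c q (Y q)) (Z q)) p (X p)"
    by (rule dif_cong[OF p]) (rule J_skew)
  also have "\<dots> = - dif c (\<lambda>q. g c q (J c q (Y q)) (Z q)) p (X p)"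
    by (rule dif_minus[OF smooth_in_g[OF smooth_in_J[OF assms(1)] assms(2)] p])
  finally show ?thesis by (simp add: J_skew[OF p])
qed

end

section \<open>Consequences of a parallel 2-form\<close>

locale special_chart = parabolic_chart c \<phi> \<xi> \<Gamma> g + hermitian_chart c \<phi> \<xi> \<Gamma> g J
  for c :: "('m, 'n::finite) chart" and \<phi> \<xi> \<Gamma> g and J :: "('m, 'n) endo" +
  assumes parallel_\<omega>: "smooth_in c X \<Longrightarrow> smooth_in c Y \<Longrightarrow> smooth_in c Z \<Longrightarrow> p \<in> cdom c \<Longrightarrow>
      dif c (\<lambda>q. g c q (J c q (Y q)) (Z q)) p (X p)
        - g c p (J c p (cov \<Gamma> c X Y p)) (Z p) - g c p (J c p (Y p)) (cov \<Gamma> c X Z p) = 0"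
begin

lemma parallel_kaehler_form:
  assumes "smooth_in c X" "smooth_in c Y" "smooth_in c Z" and p: "p \<in> cdom c"
  shows "dif c (\<lambda>q. g c q (Y q) (J c q (Z q))) p (X p)
    - g c p (cov \<Gamma> c X Y p) (J c p (Z p)) - g c p (Y p) (J c p (cov \<Gamma> c X Z p)) = 0"
  by (simp only: cov_kaehler_form[OF assms(2,3) p] parallel_\<omega>[OF assms] minus_zero)

lemma cov_J_sym:
  assumes "smooth_in c X" "smooth_in c Y" and p: "p \<in> cdom c"
  shows "cov_endo \<Gamma> J c X Y p - cov_endo \<Gamma> J c Y X p = 0" (is "?D = 0")
proof -
  \<comment> \<open>Parallelism of \<omega> = g(J\<cdot>, \<cdot>) is applied to J Y in place of Y:
    since \<omega>(J Y, Z) = - g(Y, Z), it expresses the covariant derivative of \<open>g\<close>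
    through that of \<open>J\<close>.\<close>
  have key: "dif c (\<lambda>q. g c q (Y q) (Z q)) p (X p)
      - g c p (cov \<Gamma> c X Y p) (Z p) - g c p (Y p) (cov \<Gamma> c X Z p) =
      - g c p (J c p (cov_endo \<Gamma> J c X Y p)) (Z p)"
    if "smooth_in c X" "smooth_in c Y" "smooth_in c Z" for X Y Z
  proof -
    have "dif c (\<lambda>q. g c q (J c q (J c q (Y q))) (Z q)) p (X p) = dif c (\<lambda>q. - g c q (Y q) (Z q)) p (X p)"
      by (rule dif_cong[OF p]) (simp add: J_J bilinear_lneg[OF bilinear_g])
    also have "\<dots> = - dif c (\<lambda>q. g c q (Y q) (Z q)) p (X p)"
      by (intro dif_minus smooth_in_g that p)
    finally show ?thesis
      using parallel_\<omega>[OF that(1) smooth_in_J[OF that(2)] that(3) p]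
      by (simp add: J_J[OF p] cov_endo_def linear_diff[OF linear_J[OF p]]
          bilinear_lneg[OF bilinear_g[OF p]] bilinear_lsub[OF bilinear_g[OF p]] bilinear_ladd[OF bilinear_g[OF p]])
  qed
  \<comment> \<open>The Codazzi equation makes the right-hand side of \<open>key\<close> symmetric
    in \<open>X\<close> and \<open>Y\<close>; constant fields reach every vector \<open>v\<close> at
    \<open>p\<close>.\<close>
  have "g c p (J c p ?D) v = 0" for v
    using codazzi[OF assms(1,2) smooth_in_const p, of v]
    unfolding key[OF assms(1,2) smooth_in_const] key[OF assms(2,1) smooth_in_const]
    by (simp add: linear_diff[OF linear_J[OF p]] bilinear_lsub[OF bilinear_g[OF p]])
  then have "J c p ?D = 0" by (rule nondegenerate_g[OF p])
  then show ?thesis using J_J[OF p, of ?D] linear_0[OF linear_J[OF p]] by simp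
qed

text \<open>For a torsion-free connection the exterior derivative is the alternating sum of
  covariant derivatives, and each of these vanishes here. Skew-symmetry brings the terms with
  differentiated arguments to matching slots.\<close>

lemma closed_kaehler_form:
  assumes "smooth_in c X" "smooth_in c Y" "smooth_in c Z" and p: "p \<in> cdom c"
  shows "dif c (\<lambda>q. g c q (Y q) (J c q (Z q))) p (X p)
    - dif c (\<lambda>q. g c q (X q) (J c q (Z q))) p (Y p)
    + dif c (\<lambda>q. g c q (X q) (J c q (Y q))) p (Z p)
    - g c p (bracket c X Y p) (J c p (Z p))
    + g c p (bracket c X Z p) (J c p (Y p))
    - g c p (bracket c Y Z p) (J c p (X p)) = 0"
proof -
  let ?\<omega> = "\<lambda>u v. g c p u (J c p v)"
  have skew: "?\<omega> u v = - ?\<omega> v u" for u v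
    using J_skew[OF p, of u v] sym_g[OF p] by metis
  have sub: "?\<omega> (u - u') v = ?\<omega> u v - ?\<omega> u' v" for u u' v
    by (rule bilinear_lsub[OF bilinear_g[OF p]])
  show ?thesis
    using parallel_kaehler_form[OF assms(1-3) p] parallel_kaehler_form[OF assms(2,1,3) p]
      parallel_kaehler_form[OF assms(3,1,2) p]
      skew[of "Y p" "cov \<Gamma> c X Z p"] skew[of "X p" "cov \<Gamma> c Y Z p"] skew[of "X p" "cov \<Gamma> c Z Y p"]
    unfolding cov_torsion[OF p, symmetric] sub by linarith
qed

end

section \<open>Holomorphic coordinates\<close>

context special_chart
begin

lemma holomorphic_coordinates:
  assumes p0: "p0 \<in> cdom c"
  obtains U V :: "(real ^ 'n) set" and W G J0 :: "real ^ 'n \<Rightarrow> real ^ 'n" where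
    "open U" "U \<subseteq> cmap c ` cdom c" "cmap c p0 \<in> U" "open V" "homeomorphism U V W G"
    "smooth_on U W" "smooth_on V G" "linear J0" "\<And>v. J0 (J0 v) = - v"
    "\<And>q v. q \<in> cdom c \<Longrightarrow> cmap c q \<in> U \<Longrightarrow>
      frechet_derivative W (at (cmap c q)) (J c q v) = J0 (frechet_derivative W (at (cmap c q)) v)"
proof -
  obtain e where e: "e > 0" and eU: "ball (cmap c p0) e \<subseteq> cmap c ` cdom c"
    using open_image p0 openE by (metis imageI)
  \<comment> \<open>A ball, because both the constancy of \<open>\<xi>\<close> and the existence of
    the potential are obtained on a convex set.\<close>
  define B where "B = ball (cmap c p0) e"
  have B: "open B" "convex B" "cmap c p0 \<in> B" "B \<subseteq> cmap c ` cdom c"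
    using e eU by (auto simp: B_def)
  have cinvB: "cinv c x \<in> cdom c" "cmap c (cinv c x) = x" if "x \<in> B" for x
    using B(4) that by (auto intro: inv_into_into f_inv_into_f)
  have "((\<xi> \<circ> cinv c) has_derivative (\<lambda>h. 0)) (at x within B)" if "x \<in> B" for x
  proof -
    have "dif c \<xi> (cinv c x) = (\<lambda>h. 0)" using dif_\<xi>[OF cinvB(1)[OF that]] by (rule ext)
    then show ?thesis
      using has_derivative_dif[OF smooth_\<xi> cinvB(1)[OF that]] cinvB(2)[OF that]
      by (simp add: has_derivative_at_withinI)
  qed
  from has_derivative_zero_constant[OF B(2) this]
  have \<xi>_const: "\<xi> (cinv c x) = \<xi> p0" if "x \<in> B" for x
    using B(3) that cinv_cmap[OF p0] by force
  \<comment> \<open>\<open>\<pi>\<close> is the first component of a left inverse of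
    \<open>?T\<close>, which is injective by transversality. Hence it kills \<open>\<xi> p0\<close>
    and makes the differential of the flat coordinates the identity at \<open>p0\<close>.\<close>
  obtain \<pi> where lin\<pi>: "linear \<pi>" and \<pi>\<phi>: "\<And>v. \<pi> (dif c \<phi> p0 v) = v" and \<pi>\<xi>: "\<pi> (\<xi> p0) = 0"
  proof -
    let ?T = "\<lambda>(v, t). dif c \<phi> p0 v + t *\<^sub>R \<xi> p0"
    have linT: "linear ?T"
      by (rule linearI) (auto simp: linear_add[OF linear_\<phi>[OF p0]] linear_cmul[OF linear_\<phi>[OF p0]] algebra_simps)
    moreover have "inj ?T"
      unfolding linear_injective_0[OF linT]
      using tangent_transversal_independent[OF p0] by (auto simp: zero_prod_def)
    ultimately obtain S where S: "linear S" "S \<circ> ?T = id"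
      using linear_injective_left_inverse by blast
    have "S (dif c \<phi> p0 v + t *\<^sub>R \<xi> p0) = (v, t)" for v t
      using fun_cong[OF S(2), of "(v, t)"] by simp
    from this[of _ 0] this[of 0 1] show ?thesis
      by (intro that[of "fst \<circ> S"] linear_compose[OF S(1) linear_fst])
        (auto simp: linear_0[OF linear_\<phi>[OF p0]])
  qed
  have bl\<pi>: "bounded_linear \<pi>" using lin\<pi> linear_conv_bounded_linear by blast
  let ?J0 = "J c p0"
  note linJ0 = linear_J[OF p0]
  have blJ0: "bounded_linear ?J0" using linJ0 linear_conv_bounded_linear by blast
  \<comment> \<open>\<open>P\<close> is the differential of the flat coordinates \<pi> \<circ>
    \<phi>, and \<open>\<alpha>\<close> below is its composite with \<open>J\<close>, read in the
    chart \<open>c\<close>.\<close>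
  define P where "P q v = \<pi> (dif c \<phi> q v)" for q v
  have linP: "linear (P q)" if "q \<in> cdom c" for q
    unfolding P_def using linear_compose[OF linear_\<phi>[OF that] lin\<pi>] by (simp add: o_def)
  have smP: "smooth_in c (\<lambda>q. P q (X q))" if "smooth_in c X" for X
    unfolding P_def by (rule smooth_in_linear[OF bl\<pi> smooth_in_dif[OF smooth_\<phi> that]])
  define \<alpha> where "\<alpha> x v = P (cinv c x) (J c (cinv c x) v)" for x v
  have smPJ: "smooth_in c (\<lambda>q. P q (J c q v))" for v
    by (rule smP[OF smooth_J])
  have lin\<alpha>: "linear (\<alpha> x)" if "x \<in> B" for x
    unfolding \<alpha>_def using linear_compose[OF linear_J linP] cinvB(1)[OF that] by (simp add: o_def)
  have \<alpha>Ck: "Ck_on k B (\<lambda>x. \<alpha> x v)" for k v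
    using Ck_on_subset[OF smooth_in_Ck[OF smPJ] B(4)] by (simp add: \<alpha>_def o_def)
  \<comment> \<open>The Gauss formula for \<open>J\<close> applied to a constant field; since
    \<open>\<xi>\<close> is constant on \<open>B\<close>, \<open>\<pi>\<close> removes the
    transversal term everywhere and not only at \<open>p0\<close>.\<close>
  have d\<alpha>: "frechet_derivative (\<lambda>y. \<alpha> y v) (at x) u = P (cinv c x) (cov \<Gamma> c (\<lambda>_. u) (\<lambda>q. J c q v) (cinv c x))"
    if "x \<in> B" for x u v
  proof -
    have "frechet_derivative (\<lambda>y. \<alpha> y v) (at x) u = dif c (\<lambda>q. \<pi> (dif c \<phi> q (J c q v))) (cinv c x) u"
      using cinvB(2)[OF that] by (simp add: dif_def \<alpha>_def P_def o_def)
    also have "\<dots> = \<pi> (dif c (\<lambda>q. dif c \<phi> q (J c q v)) (cinv c x) u)"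
      by (rule dif_linear[OF bl\<pi> smooth_in_dif[OF smooth_\<phi> smooth_J] cinvB(1)[OF that]])
    finally show ?thesis
      using gauss[OF smooth_in_const smooth_J cinvB(1)[OF that], of v u]
      by (simp add: \<xi>_const[OF that] linear_add[OF lin\<pi>] linear_cmul[OF lin\<pi>] \<pi>\<xi> P_def)
  qed
  \<comment> \<open>Closedness of \<open>\<alpha>\<close>: for constant \<open>u\<close> and
    \<open>v\<close> it is the symmetry of the covariant derivative of \<open>J\<close>, once the
    remaining terms cancel by the symmetry of \<open>\<Gamma>\<close>.\<close>
  have "frechet_derivative (\<lambda>y. \<alpha> y v) (at x) u = frechet_derivative (\<lambda>y. \<alpha> y u) (at x) v"
    if "x \<in> B" for x u v
    using cov_J_sym[OF smooth_in_const smooth_in_const cinvB(1)[OF that], of u v]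
      \<Gamma>_sym[OF cinvB(1)[OF that], of u v]
    by (simp add: d\<alpha>[OF that] cov_endo_def) (simp add: cov_def dif_const)
  from closed_1form_potential[OF B(1-3) lin\<alpha> \<alpha>Ck this]
  obtain y where y: "\<And>x. x \<in> B \<Longrightarrow> (y has_derivative \<alpha> x) (at x)" by blast
  define W where "W x = \<pi> (\<phi> (cinv c x)) - ?J0 (y x)" for x
  define W' where "W' x v = P (cinv c x) v - ?J0 (\<alpha> x v)" for x v
  have dW: "(W has_derivative W' x) (at x)" if "x \<in> B" for x
  proof -
    have "((\<lambda>x. \<phi> (cinv c x)) has_derivative dif c \<phi> (cinv c x)) (at x)"
      using has_derivative_dif[OF smooth_\<phi> cinvB(1)[OF that]] cinvB(2)[OF that] by (simp add: o_def)
    from bounded_linear.has_derivative[OF bl\<pi> this] bounded_linear.has_derivative[OF blJ0 y[OF that]]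
    show ?thesis unfolding W_def W'_def P_def by (rule has_derivative_diff)
  qed
  have W'_Ck: "Ck_on k B (\<lambda>x. W' x v)" for k v
  proof -
    have "Ck_on k B (\<lambda>x. P (cinv c x) v + - ?J0 (\<alpha> x v))"
      using Ck_on_subset[OF smooth_in_Ck[OF smP[OF smooth_in_const]] B(4), of k v]
      by (intro Ck_on_add[OF B(1)] Ck_on_bounded_linear[OF B(1) bounded_linear_minus[OF blJ0]] \<alpha>Ck)
        (simp add: o_def)
    then show ?thesis by (simp add: W'_def)
  qed
  have W_smooth: "smooth_on B W"
    unfolding smooth_on_def using Ck_on_SucI[OF B(1) dW W'_Ck] Ck_on_Suc_imp by blast
  \<comment> \<open>The inverse function theorem takes the derivative as a continuous family of
    bounded linear maps.\<close>
  define DW where "DW x = Blinfun (W' x)" for x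
  have DW: "blinfun_apply (DW x) = W' x" if "x \<in> B" for x
    unfolding DW_def using has_derivative_bounded_linear[OF dW[OF that]]
    by (rule bounded_linear_Blinfun_apply)
  \<comment> \<open>At \<open>p0\<close> the differential \<open>P\<close> is the identity and
    \<open>\<alpha>\<close> is \<open>?J0\<close>, so \<open>W'\<close> is the identity minus the
    square of \<open>?J0\<close>; half the identity inverts it.\<close>
  have W'_p0: "W' (cmap c p0) v = 2 *\<^sub>R v" for v
    by (simp add: W'_def \<alpha>_def P_def cinv_cmap[OF p0] \<pi>\<phi> J_J[OF p0] scaleR_2)
  have "continuous_on B DW"
    by (rule continuous_on_blinfun_componentwise, rule continuous_on_eq[of B "\<lambda>x. W' x _"])
      (use W'_Ck[of 0] DW in auto)
  moreover have "((1/2) *\<^sub>R id_blinfun) o\<^sub>L DW (cmap c p0) = id_blinfun"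
    by (rule blinfun_eqI) (simp add: DW[OF B(3)] W'_p0 blinfun.scaleR_left)
  ultimately obtain U V G G' where U: "open U" "U \<subseteq> B" "cmap c p0 \<in> U" and V: "open V"
    and hom: "homeomorphism U V W G"
    and G: "\<And>y. y \<in> V \<Longrightarrow> (G has_derivative G' y) (at y)"
    and G': "\<And>y. y \<in> V \<Longrightarrow> G' y = inv (blinfun_apply (DW (G y)))"
    and bij: "\<And>y. y \<in> V \<Longrightarrow> bij (blinfun_apply (DW (G y)))"
    using inverse_function_theorem[of B W DW "cmap c p0"] B(1,3) dW DW by metis
  have fW: "frechet_derivative W (at x) = W' x" if "x \<in> B" for x
    using frechet_derivative_at[OF dW[OF that]] by simp
  have GU: "G y \<in> U" if "y \<in> V" for y using hom that by (auto simp: homeomorphism_def)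
  have smU: "smooth_on U W"
    by (rule smooth_on_subset[OF W_smooth U(2)])
  \<comment> \<open>The inverse function theorem gives only the first derivative of
    \<open>G\<close>; its right-inverse property is what yields the higher ones.\<close>
  have "frechet_derivative W (at (G y)) (G' y v) = v" if "y \<in> V" for y v
    using GU[OF that] U(2) bij[OF that] G'[OF that] DW[of "G y"] fW[of "G y"]
    by (metis bij_is_surj subsetD surj_f_inv_f)
  then have smV: "smooth_on V G"
    unfolding smooth_on_def using Ck_on_local_inverse[OF U(1) V hom smU G] by blast
  \<comment> \<open>Applying \<open>W'\<close> after \<open>J\<close> exchanges its two terms up to
    a factor \<open>?J0\<close>, because both \<open>J\<close> and \<open>?J0\<close> square to
    minus the identity.\<close>
  have "frechet_derivative W (at (cmap c q)) (J c q v) = ?J0 (frechet_derivative W (at (cmap c q)) v)"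
    if "q \<in> cdom c" "cmap c q \<in> U" for q v
  proof -
    have "cmap c q \<in> B" using that U by blast
    then show ?thesis
      by (simp add: fW W'_def \<alpha>_def cinv_cmap[OF that(1)] J_J[OF that(1)] J_J[OF p0]
          linear_neg[OF linP[OF that(1)]] linear_neg[OF linJ0] linear_diff[OF linJ0])
  qed
  with U V hom smU smV linJ0 J_J[OF p0] B(4) show ?thesis by (intro that[of U V W G ?J0]) auto
qed

end

section \<open>Charts of the smooth structure\<close>

lemma smooth_atlas_chart:
  assumes "smooth_atlas A" "c \<in> A"
  shows "coordinate_chart c" "open (cdom c)"
    "homeomorphism (cdom c) (cmap c ` cdom c) (cmap c) (cinv c)"
proof -
  show hom: "homeomorphism (cdom c) (cmap c ` cdom c) (cmap c) (cinv c)" and "open (cdom c)"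
    using assms by (auto simp: smooth_atlas_def)
  have "open (cmap c ` cdom c)" using assms by (auto simp: smooth_atlas_def)
  then show "coordinate_chart c"
    using hom by unfold_locales (auto simp: homeomorphism_def intro: inj_on_inverseI)
qed

lemma smooth_atlas_transition:
  assumes "smooth_atlas A" "c \<in> A" "d \<in> A"
  shows "smooth_on (cmap c ` (cdom c \<inter> cdom d)) (cmap d \<circ> cinv c)"
  using assms by (simp add: smooth_atlas_def)

lemma open_chart_image:
  assumes "smooth_atlas A" "c \<in> A" "open D" "D \<subseteq> cdom c"
  shows "open (cmap c ` D)"
proof -
  have "openin (top_of_set (cdom c)) D"
    using assms(3,4) by (simp add: open_subset)
  then have "openin (top_of_set (cmap c ` cdom c)) (cmap c ` D)"
    using homeomorphism_imp_open_map[OF smooth_atlas_chart(3)[OF assms(1,2)]] by blast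
  then show ?thesis
    using coordinate_chart.open_image[OF smooth_atlas_chart(1)[OF assms(1,2)]] openin_open_trans by blast
qed

text \<open>The new chart is \<open>c\<close>, restricted to the preimage of \<open>U\<close> and
  followed by the diffeomorphism \<open>W\<close>. Transition maps from it and to it are those of
  \<open>c\<close>, preceded by \<open>G\<close> or followed by \<open>W\<close>.\<close>

lemma smooth_atlas_insert:
  fixes A :: "('m::{t2_space, second_countable_topology}, 'n::finite) chart set"
  assumes A: "smooth_atlas A" and c: "c \<in> A"
    and U: "open U" "U \<subseteq> cmap c ` cdom c" and V: "open V" and hom: "homeomorphism U V W G"
    and W: "smooth_on U W" and G: "smooth_on V G"
    and d: "d = (cdom c \<inter> cmap c -` U, W \<circ> cmap c)"
  shows "smooth_atlas (insert d A)"
proof -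
  note homc = smooth_atlas_chart(3)[OF A c]
  define D where "D = cdom c \<inter> cmap c -` U"
  have dD: "cdom d = D" "cmap d = W \<circ> cmap c" by (simp_all add: d D_def)
  have "continuous_on (cdom c) (cmap c)" using homc by (simp add: homeomorphism_def)
  then have openD: "open D"
    unfolding D_def using continuous_open_preimage smooth_atlas_chart(2)[OF A c] U(1) by blast
  have DU: "cmap c ` D = U" using U(2) by (auto simp: D_def)
  have GU: "G v \<in> U" and WG: "W (G v) = v" if "v \<in> V" for v
    using hom that by (auto simp: homeomorphism_def)
  have WV: "W u \<in> V" and GW: "G (W u) = u" if "u \<in> U" for u
    using hom that by (auto simp: homeomorphism_def)
  have cinvU: "cinv c u \<in> D" and cmap_cinv: "cmap c (cinv c u) = u" if "u \<in> U" for u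
    using that U(2) by (auto simp: D_def f_inv_into_f inv_into_into)
  have "homeomorphism D U (cmap c) (cinv c)"
    using homeomorphism_of_subsets[OF homc _ U(2) DU] by (simp add: D_def)
  then have homD: "homeomorphism D V (cmap d) (cinv c \<circ> G)"
    unfolding dD by (rule homeomorphism_compose[OF _ hom])
  then have imgD: "cmap d ` D = V" by (simp add: homeomorphism_def)
  have inj: "inj_on (cmap d) D"
    using homD by (auto simp: homeomorphism_def intro: inj_on_inverseI)
  \<comment> \<open>\<open>cinv\<close> is defined by choice, so it has to be identified with the
    expected inverse on \<open>V\<close>.\<close>
  have cinvd: "cinv d v = cinv c (G v)" if "v \<in> V" for v
    unfolding dD(1) using inj cinvU[OF GU[OF that]]
    by (rule inv_into_f_eq) (simp add: dD cmap_cinv[OF GU[OF that]] WG[OF that])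
  have "homeomorphism D V (cmap d) (cinv d)"
    by (rule homeomorphism_cong[OF homD]) (simp_all add: cinvd)
  then have 1: "homeomorphism (cdom d) (cmap d ` cdom d) (cmap d) (cinv d)"
    using imgD by (simp add: dD(1))
  have 2: "smooth_on (cmap d ` (cdom d \<inter> cdom e)) (cmap e \<circ> cinv d)" if e: "e \<in> A" for e
  proof -
    let ?O = "cmap c ` (cdom c \<inter> cdom e)" and ?S = "cmap d ` (cdom d \<inter> cdom e)"
    have O: "open ?O"
      using open_chart_image[OF A c] smooth_atlas_chart(2)[OF A c] smooth_atlas_chart(2)[OF A e]
      by (simp add: open_Int)
    have inD: "q \<in> D \<and> G (cmap d q) = cmap c q" if "q \<in> D" for q
      using that by (auto simp: dD D_def GW)
    \<comment> \<open>Written as a preimage under the continuous map \<open>G\<close>, the domain of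
      the transition map is seen to be open.\<close>
    have S: "?S = V \<inter> G -` ?O"
    proof
      show "?S \<subseteq> V \<inter> G -` ?O"
        using imgD inD by (auto simp: dD(1)) (auto simp: D_def)
      show "V \<inter> G -` ?O \<subseteq> ?S"
      proof
        fix v assume v: "v \<in> V \<inter> G -` ?O"
        then obtain q where q: "q \<in> cdom c" "q \<in> cdom e" "G v = cmap c q" by auto
        then have "q \<in> D" "cmap d q = v"
          using GU[of v] WG[of v] v by (auto simp: D_def dD)
        then show "v \<in> ?S" using q by (auto simp: dD(1))
      qed
    qed
    have "continuous_on V G" using hom by (simp add: homeomorphism_def)
    then have openS: "open ?S" unfolding S using continuous_open_preimage V O by blast
    have SV: "?S \<subseteq> V" and GS: "G ` ?S \<subseteq> ?O" using S by auto
    show ?thesis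
      by (rule smooth_on_cong[OF openS _ smooth_on_compose[OF openS O GS
              smooth_on_subset[OF G SV] smooth_atlas_transition[OF A c e]]])
        (use SV cinvd in auto)
  qed
  have 3: "smooth_on (cmap e ` (cdom e \<inter> cdom d)) (cmap d \<circ> cinv e)" if e: "e \<in> A" for e
  proof -
    let ?S = "cmap e ` (cdom e \<inter> cdom d)"
    interpret e: coordinate_chart e by (rule smooth_atlas_chart(1)[OF A e])
    have openS: "open ?S"
      using open_chart_image[OF A e] smooth_atlas_chart(2)[OF A e] openD by (simp add: open_Int dD(1))
    have sub: "?S \<subseteq> cmap e ` (cdom e \<inter> cdom c)" by (auto simp: dD D_def)
    have "(cmap c \<circ> cinv e) ` ?S \<subseteq> U" by (auto simp: dD D_def e.cinv_cmap)
    from smooth_on_compose[OF openS U(1) this smooth_on_subset[OF smooth_atlas_transition[OF A e c] sub] W]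
    show ?thesis by (simp add: dD(2) o_def)
  qed
  have 4: "smooth_on (cmap d ` (cdom d \<inter> cdom d)) (cmap d \<circ> cinv d)"
  proof -
    have "smooth_on V (\<lambda>v. v)" by (simp add: smooth_on_def Ck_on_ident[OF V])
    then have "smooth_on V (cmap d \<circ> cinv d)"
      by (rule smooth_on_cong[OF V, rotated])
        (simp only: o_apply cinvd, simp add: dD(2) cmap_cinv[OF GU] WG)
    then show ?thesis using imgD by (simp add: dD(1))
  qed
  have "open (cdom d)" "open (cmap d ` cdom d)" using openD imgD V by (simp_all add: dD(1))
  with 1 2 3 4 A show ?thesis unfolding smooth_atlas_def by auto
qed

lemma complex_structureI:
  fixes A :: "('m::{t2_space, second_countable_topology}, 'n::finite) chart set"
  assumes A: "smooth_atlas A" and J: "almost_complex A J"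
    and charts: "\<And>c. c \<in> A \<Longrightarrow> special_chart c \<phi> \<xi> \<Gamma> g J"
  shows "complex_structure A J"
  unfolding complex_structure_def
proof (intro conjI allI J)
  fix p :: 'm
  have "p \<in> (\<Union>c\<in>A. cdom c)" using A by (simp add: smooth_atlas_def)
  then obtain c where c: "c \<in> A" and p: "p \<in> cdom c" by blast
  interpret special_chart c \<phi> \<xi> \<Gamma> g J by (rule charts[OF c])
  obtain U V :: "(real ^ 'n) set" and W G J0 :: "real ^ 'n \<Rightarrow> real ^ 'n"
    where U: "open U" "U \<subseteq> cmap c ` cdom c" "cmap c p \<in> U"
    and V: "open V" "homeomorphism U V W G"
    and WG: "smooth_on U W" "smooth_on V G" and J0: "linear J0" "\<And>v. J0 (J0 v) = - v"
    and WJ: "\<And>q v. q \<in> cdom c \<Longrightarrow> cmap c q \<in> U \<Longrightarrow>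
      frechet_derivative W (at (cmap c q)) (J c q v) = J0 (frechet_derivative W (at (cmap c q)) v)"
    by (rule holomorphic_coordinates[OF p]) (erule (7) that; simp)
  define d where "d = (cdom c \<inter> cmap c -` U, W \<circ> cmap c)"
  have "dif e (cmap d) q (J e q v) = J0 (dif e (cmap d) q v)"
    if e: "e \<in> A" and q: "q \<in> cdom e \<inter> cdom d" for e q v
  proof -
    interpret e: coordinate_chart e by (rule smooth_atlas_chart(1)[OF A e])
    have qc: "q \<in> cdom c" "cmap c q \<in> U" using q by (auto simp: d_def)
    have cq: "(cmap c \<circ> cinv e) (cmap e q) = cmap c q" using q by (simp add: e.cinv_cmap)
    have "(cmap c \<circ> cinv e) differentiable (at (cmap e q))"
      using smooth_atlas_transition[OF A e c] by (rule smooth_on_differentiable) (use q qc in auto)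
    moreover have "W differentiable (at ((cmap c \<circ> cinv e) (cmap e q)))"
      unfolding cq using WG(1) qc(2) by (rule smooth_on_differentiable)
    ultimately have "frechet_derivative (W \<circ> (cmap c \<circ> cinv e)) (at (cmap e q)) =
        frechet_derivative W (at (cmap c q)) \<circ> frechet_derivative (cmap c \<circ> cinv e) (at (cmap e q))"
      using frechet_derivative_compose[of "cmap c \<circ> cinv e" "cmap e q" W] unfolding cq by blast
    \<comment> \<open>The intertwining relation is known in the chart \<open>c\<close>; the chain
      rule and the transformation law of \<open>J\<close> carry it to every chart \<open>e\<close>
      of the atlas.\<close>
    then have chain: "dif e (cmap d) q u = frechet_derivative W (at (cmap c q)) (dif e (cmap c) q u)" for u
      by (simp add: dif_def d_def comp_assoc)
    have "dif e (cmap c) q (J e q v) = J c q (dif e (cmap c) q v)"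
      using J e c q qc(1) by (simp add: almost_complex_def endo_field_def)
    then show ?thesis by (simp add: chain WJ[OF qc])
  qed
  moreover have "p \<in> cdom d" using p U(3) by (simp add: d_def)
  moreover have "smooth_atlas (insert d A)"
    by (rule smooth_atlas_insert[OF A c U(1,2) V WG d_def])
  ultimately show "\<exists>d J0. p \<in> cdom d \<and> smooth_atlas (insert d A) \<and>
        linear J0 \<and> (\<forall>v. J0 (J0 v) = - v) \<and>
        (\<forall>c\<in>A. \<forall>q\<in>cdom c \<inter> cdom d. \<forall>v.
           dif c (cmap d) q (J c q v) = J0 (dif c (cmap d) q v))"
    using J0 by blast
qed

section \<open>From the global hypotheses to the charts, and back\<close>

text \<open>With vanishing shape tensor the Weingarten formula leaves a multiple of
  \<open>\<xi>\<close>, and this multiple is zero because the induced volume form, being equal to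
  the metric one, is parallel.\<close>

lemma parabolic_sphere_chart:
  assumes A: "smooth_atlas A" and ps: "parabolic_sphere A \<phi> \<xi> \<Gamma> g" and c: "c \<in> A"
  shows "parabolic_chart c \<phi> \<xi> \<Gamma> g"
proof -
  obtain S \<tau> where bl: "blaschke_immersion A \<phi> \<xi> \<Gamma> g S \<tau>"
    and S: "\<forall>c\<in>A. \<forall>p\<in>cdom c. \<forall>v. S c p v = 0 *\<^sub>R v"
    using ps unfolding parabolic_sphere_def affine_hypersphere_def by blast
  have imm: "immersion A \<phi>" "transversal_field A \<phi> \<xi>"
    and ind: "induced_data A \<phi> \<xi> \<Gamma> g S \<tau>" and pr: "pseudo_riemannian A g"
    using bl by (simp_all add: blaschke_immersion_def)
  obtain ori where par: "parallel_vol A \<Gamma> (metric_vol g ori)"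
    and vol: "\<forall>c\<in>A. \<forall>p\<in>cdom c. \<forall>X. metric_vol g ori c p X = induced_vol \<phi> \<xi> c p X"
    using bl unfolding blaschke_immersion_def by blast
  have gauss: "\<forall>c\<in>A. \<forall>X Y. smooth_in c X \<longrightarrow> smooth_in c Y \<longrightarrow>
      (\<forall>p\<in>cdom c. dif c (\<lambda>q. dif c \<phi> q (Y q)) p (X p) =
         dif c \<phi> p (cov \<Gamma> c X Y p) + g c p (X p) (Y p) *\<^sub>R \<xi> p)"
    and weingarten: "\<forall>c\<in>A. \<forall>X. smooth_in c X \<longrightarrow>
      (\<forall>p\<in>cdom c. dif c \<xi> p (X p) = - dif c \<phi> p (S c p (X p)) + \<tau> c p (X p) *\<^sub>R \<xi> p)"
    using ind unfolding induced_data_def by - (elim conjE, assumption)+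
  interpret coordinate_chart c by (rule smooth_atlas_chart(1)[OF A c])
  have "connection A \<Gamma>" "bilinear_form A g" using ind by (simp_all add: induced_data_def)
  interpret gauss_chart c \<phi> \<xi> \<Gamma> g
  proof unfold_locales
    show "\<And>p. p \<in> cdom c \<Longrightarrow> inj (dif c \<phi> p)" "smooth_in c \<phi>"
      using imm(1) c by (simp_all add: immersion_def)
    show "smooth_in c \<xi>" "\<And>p. p \<in> cdom c \<Longrightarrow> \<xi> p \<notin> range (dif c \<phi> p)"
      using imm(2) c by (simp_all add: transversal_field_def)
    show "\<And>p. p \<in> cdom c \<Longrightarrow> bilinear (\<Gamma> c p)" "\<And>u v. smooth_in c (\<lambda>p. \<Gamma> c p u v)"
      using \<open>connection A \<Gamma>\<close> c by (simp_all add: connection_def)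
    show "\<And>p. p \<in> cdom c \<Longrightarrow> bilinear (g c p)" "\<And>u v. smooth_in c (\<lambda>p. g c p u v)"
      using \<open>bilinear_form A g\<close> c by (simp_all add: bilinear_form_def)
    show "\<And>p u v. p \<in> cdom c \<Longrightarrow> g c p u v = g c p v u"
      and "\<And>p u. p \<in> cdom c \<Longrightarrow> (\<And>v. g c p u v = 0) \<Longrightarrow> u = 0"
      using pr c by (auto simp: pseudo_riemannian_def)
    show "dif c (\<lambda>q. dif c \<phi> q (Y q)) p (X p) =
        dif c \<phi> p (cov \<Gamma> c X Y p) + g c p (X p) (Y p) *\<^sub>R \<xi> p"
      if "smooth_in c X" "smooth_in c Y" "p \<in> cdom c" for X Y p
      using gauss[rule_format, OF c that] .
  qed
  have "dif c \<xi> p v = 0" if p: "p \<in> cdom c" for p v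
  proof -
    have "dif c \<xi> p v = - dif c \<phi> p (S c p v) + \<tau> c p v *\<^sub>R \<xi> p"
      by (rule weingarten[rule_format, OF c smooth_in_const p])
    then have w: "dif c \<xi> p v = \<tau> c p v *\<^sub>R \<xi> p"
      using linear_0[OF linear_\<phi>[OF p]] by (simp add: S[rule_format, OF c p])
    \<comment> \<open>The constant coordinate frame, for which covariant derivatives reduce to
      Christoffel symbols.\<close>
    let ?Y = "\<lambda>i q. axis i 1 :: real ^ 'b"
    have "dif c (\<lambda>q. metric_vol g ori c q (\<lambda>i. ?Y i q)) p v
        - (\<Sum>i\<in>UNIV. metric_vol g ori c p ((\<lambda>j. ?Y j p)(i := cov \<Gamma> c (\<lambda>_. v) (?Y i) p))) = 0"
      by (rule par[unfolded parallel_vol_def, rule_format, OF c smooth_in_const smooth_in_const p])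
    moreover have "dif c (\<lambda>q. metric_vol g ori c q (\<lambda>i. ?Y i q)) p v =
        dif c (\<lambda>q. induced_vol \<phi> \<xi> c q (\<lambda>i. axis i 1)) p v"
      by (rule dif_cong[OF p]) (rule vol[rule_format, OF c])
    ultimately have "\<tau> c p v = 0"
      by (intro transversal_form_eq_0[OF p w]) (simp add: vol[rule_format, OF c p] cov_def dif_const)
    then show ?thesis using w by simp
  qed
  then show ?thesis by unfold_locales
qed

lemma hermitian_chartI:
  assumes "gauss_chart c \<phi> \<xi> \<Gamma> g" "almost_complex A J" "hermitian A J g" "c \<in> A"
  shows "hermitian_chart c \<phi> \<xi> \<Gamma> g J"
  by (intro hermitian_chart.intro hermitian_chart_axioms.intro assms(1))
    (use assms(2-4) in \<open>simp_all add: almost_complex_def endo_field_def hermitian_def\<close>)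

theorem theorem3p6:
  fixes A :: "('m::{t2_space, second_countable_topology}, 'n::finite) chart set"
    and \<phi> \<xi> :: "'m \<Rightarrow> real ^ 'n option"
    and \<Gamma> :: "('m, 'n) conn"
    and g :: "('m, 'n) form2"
  assumes "smooth_atlas A"
    and "parabolic_sphere A \<phi> \<xi> \<Gamma> g"
  shows "(\<exists>J. special_kaehler A J \<Gamma> g) \<longleftrightarrow> special_parabolic A \<Gamma> g"
proof
  assume "\<exists>J. special_kaehler A J \<Gamma> g"
  then obtain J where J: "almost_complex A J" and H: "hermitian A J g"
    and P: "parallel2 A \<Gamma> (kaehler_form J g)"
    by (auto simp: special_kaehler_def kaehler_def complex_structure_def)
  \<comment> \<open>The Kaehler form is parallel by assumption; in each chart a change of sign gives
    the form required here.\<close>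
  have "parallel2 A \<Gamma> (\<lambda>c p u v. g c p (J c p u) v)"
    unfolding parallel2_def
  proof (intro ballI allI impI)
    fix c :: "('m, 'n) chart" and X Y Z :: "'m \<Rightarrow> real ^ 'n" and p
    assume c: "c \<in> A" and sm: "smooth_in c X" "smooth_in c Y" "smooth_in c Z" and p: "p \<in> cdom c"
    interpret parabolic_chart c \<phi> \<xi> \<Gamma> g by (rule parabolic_sphere_chart[OF assms c])
    interpret hermitian_chart c \<phi> \<xi> \<Gamma> g J
      by (rule hermitian_chartI[OF _ J H c]) unfold_locales
    have "dif c (\<lambda>q. g c q (Y q) (J c q (Z q))) p (X p)
        - g c p (cov \<Gamma> c X Y p) (J c p (Z p)) - g c p (Y p) (J c p (cov \<Gamma> c X Z p)) = 0"
      using P c sm p unfolding parallel2_def kaehler_form_def by blast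
    then show "dif c (\<lambda>q. g c q (J c q (Y q)) (Z q)) p (X p)
        - g c p (J c p (cov \<Gamma> c X Y p)) (Z p) - g c p (J c p (Y p)) (cov \<Gamma> c X Z p) = 0"
      unfolding cov_kaehler_form[OF sm(2,3) p] by simp
  qed
  then show "special_parabolic A \<Gamma> g"
    unfolding special_parabolic_def using J H by blast
next
  assume "special_parabolic A \<Gamma> g"
  then obtain J where J: "almost_complex A J" and H: "hermitian A J g"
    and P: "parallel2 A \<Gamma> (\<lambda>c p u v. g c p (J c p u) v)"
    by (auto simp: special_parabolic_def)
  \<comment> \<open>The same \<open>J\<close> serves for the Kaehler structure; closedness, the
    parallel Kaehler form and the equation \<open>d\<^sup>\<nabla> J = 0\<close> are then read off
    chart by chart.\<close>
  have chart: "special_chart c \<phi> \<xi> \<Gamma> g J" if c: "c \<in> A" for c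
  proof -
    interpret parabolic_chart c \<phi> \<xi> \<Gamma> g by (rule parabolic_sphere_chart[OF assms c])
    interpret hermitian_chart c \<phi> \<xi> \<Gamma> g J
      by (rule hermitian_chartI[OF _ J H c]) unfold_locales
    show ?thesis
      by unfold_locales (use P c in \<open>unfold parallel2_def, blast\<close>)
  qed
  have pr: "pseudo_riemannian A g" and conn: "connection A \<Gamma>"
    using assms(2) by (auto simp: parabolic_sphere_def affine_hypersphere_def
        blaschke_immersion_def induced_data_def)
  have "closed2 A (kaehler_form J g)"
    unfolding closed2_def kaehler_form_def
    by (intro ballI allI impI special_chart.closed_kaehler_form[OF chart])
  then have "kaehler A J g"
    using complex_structureI[OF assms(1) J chart] pr H by (simp add: kaehler_def)
  moreover have "torsion_free A \<Gamma>"
    unfolding torsion_free_def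
    by (intro ballI allI impI
        gauss_chart.cov_torsion[OF parabolic_chart.axioms(1)[OF parabolic_sphere_chart[OF assms]]])
  moreover have "flat A \<Gamma>"
    unfolding flat_def
    by (intro ballI allI impI parabolic_chart.curvature_eq_0[OF parabolic_sphere_chart[OF assms]])
  moreover have "parallel2 A \<Gamma> (kaehler_form J g)"
    unfolding parallel2_def kaehler_form_def
    by (intro ballI allI impI special_chart.parallel_kaehler_form[OF chart])
  moreover have "\<forall>c\<in>A. \<forall>X Y. smooth_in c X \<longrightarrow> smooth_in c Y \<longrightarrow>
      (\<forall>p\<in>cdom c. cov_endo \<Gamma> J c X Y p - cov_endo \<Gamma> J c Y X p = 0)"
    by (intro ballI allI impI special_chart.cov_J_sym[OF chart])
  ultimately show "\<exists>J. special_kaehler A J \<Gamma> g"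
    unfolding special_kaehler_def using conn by blast
qed

end
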